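(* Let $\beta\in(0,1)$, $p\in(0,1)$, $q=1-p$ and $c=q^{-1}$. Let $(n')$ be a subsequence of the positive integers, written as $n'=k(m_{n'})r_{n'}$, such that $r_{n'}\to r$ for some $r\in[1,c]$. Then for any sequence $(x_{n'})\subseteq(-\infty,0]$ with $x_{n'}\to x<0$ we have, as $n'\to\infty$, $$\mathbb{P}\left(a_{n'}^{\circ}(M_{n'}-1)\le x_{n'}\right)\to\left(H_{\beta,q}(x)\right)^{pr}.$$
   Context: For $\beta,p\in(0,1)$, $q=1-p$, let $(\varepsilon_j)_{j\in\mathbb{Z}}$ be i.i.d. with $\mathbb{P}(\varepsilon_j=0)=p$ and $\mathbb{P}(\varepsilon_j=1-\beta)=q$. Let $X_k=\sum_{j=0}^\infty\beta^j\varepsilon_{k-j}$, $k\in\mathbb{N}_0$, be the strictly stationary solution of the AR(1) recursion $X_{k+1}=\beta X_k+\varepsilon_{k+1}$; its marginal distribution function is denoted $F_{\beta,p}$. $F_{\beta,q}$ denotes the same object with $p$ replaced by $q$. Let $M_n=\max\{X_0,\ldots,X_{n-1}\}$. The function $\nu_{\beta,q}^{\to}:\mathbb{R}\to(0,\infty)$ is the (existing, unique, continuous) $\log(1/\beta)$-periodic function such that $F_{\beta,q}(y)=y^{\log q/\log\beta}\,\nu_{\beta,q}^{\to}(\log y)$ for all $y\in(0,1)$ if $\beta\in(0,\frac12]$, respectively for all $y\in(0,\frac1\beta-1]$ if $\beta\in(\frac12,1)$. Define $$H_{\beta,q}(x)=\exp\left(-(-x)^{\log q/\log\beta}\,\nu_{\beta,q}^{\to}(\log(-x))\right)\text{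 for }x<0,\qquad H_{\beta,q}(x)=1\text{ for }x\ge0.$$ Let $k(n)=\lfloor q^{-n}\rfloor$. For $n\ge k(1)$ write $n=k(m_n)r_n$, where $m_n\in\mathbb{N}$ is uniquely determined by $k(m_n)\le n<k(m_n+1)$ and $r_n=n/k(m_n)\ge1$. Set $a_n^{\circ}=\beta^{-m_n}$. *)

theory Defs
  imports "HOL-Probability.Probability"
begin

definition ar1_innovations :: "'a measure \<Rightarrow> real \<Rightarrow> real \<Rightarrow> (int \<Rightarrow> 'a \<Rightarrow> real) \<Rightarrow> bool" where
  "ar1_innovations M \<beta> p \<epsilon> \<longleftrightarrow>
     prob_space M \<and> prob_space.indep_vars M (\<lambda>_. borel) \<epsilon> UNIV \<and>
     (\<forall>j. measure M {\<omega> \<in> space M. \<epsilon> j \<omega> = 0} = p \<and>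
          measure M {\<omega> \<in> space M. \<epsilon> j \<omega> = 1 - \<beta>} = 1 - p)"

text \<open>The series converges for almost every \<open>\<omega>\<close>, since the innovations are almost surely
  in \<open>{0, 1 - \<beta>}\<close>.\<close>

definition ar1_process :: "real \<Rightarrow> (int \<Rightarrow> 'a \<Rightarrow> real) \<Rightarrow> nat \<Rightarrow> 'a \<Rightarrow> real" where
  "ar1_process \<beta> \<epsilon> k \<omega> = (\<Sum>j. \<beta> ^ j * \<epsilon> (int k - int j) \<omega>)"

definition ar1_max :: "real \<Rightarrow> (int \<Rightarrow> 'a \<Rightarrow> real) \<Rightarrow> nat \<Rightarrow> 'a \<Rightarrow> real" where
  "ar1_max \<beta> \<epsilon> n \<omega> = Max ((\<lambda>k. ar1_process \<beta> \<epsilon> k \<omega>) ` {0..<n})"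

text \<open>The marginal distribution function depends only on \<open>\<beta>\<close> and \<open>p\<close>, so it is defined on the
  canonical coin-tossing space. Lemma \<open>ar1_cdf_eq\<close> below shows that any other choice
  of innovations gives the same function.\<close>

definition coin_space :: "real \<Rightarrow> (int \<Rightarrow> bool) measure" where
  "coin_space p = Pi\<^sub>M UNIV (\<lambda>_. measure_pmf (bernoulli_pmf p))"

definition coin_innovation :: "real \<Rightarrow> int \<Rightarrow> (int \<Rightarrow> bool) \<Rightarrow> real" where
  "coin_innovation \<beta> j \<omega> = (if \<omega> j then 0 else 1 - \<beta>)"

definition ar1_cdf :: "real \<Rightarrow> real \<Rightarrow> real \<Rightarrow> real" where
  "ar1_cdf \<beta> p y = measure (coin_space p)
     {\<omega> \<in> space (coin_space p). ar1_process \<beta> (coin_innovation \<beta>) 0 \<omega> \<le> y}"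

lemma ar1_innovations_coin:
  assumes "0 < \<beta>" "\<beta> < 1" "0 < p" "p < 1"
  shows "ar1_innovations (coin_space p) \<beta> p (coin_innovation \<beta>)"
proof -
  let ?B = "\<lambda>_::int. measure_pmf (bernoulli_pmf p)"
  interpret P: product_prob_space ?B UNIV ..
  have ind: "prob_space.indep_vars (coin_space p) ?B (\<lambda>j \<omega>. \<omega> j) UNIV"
  proof -
    have "distr (Pi\<^sub>M UNIV ?B) (Pi\<^sub>M UNIV ?B) (\<lambda>x. x) = Pi\<^sub>M UNIV ?B"
      by (rule distr_id)
    moreover have "distr (Pi\<^sub>M UNIV ?B) (?B j) (\<lambda>\<omega>. \<omega> j) = ?B j" for j
      by (rule distr_PiM_component) (auto intro: measure_pmf.prob_space_axioms)
    moreover have "(\<lambda>\<omega>. \<omega> j) \<in> measurable (Pi\<^sub>M UNIV ?B) (?B j)" for j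
      by (rule measurable_component_singleton) simp
    ultimately show ?thesis
      unfolding coin_space_def
      by (subst P.indep_vars_iff_distr_eq_PiM') (simp_all add: restrict_def)
  qed
  interpret C: prob_space "coin_space p"
    unfolding coin_space_def by (rule P.prob_space_axioms)
  have "C.indep_vars (\<lambda>_. borel)
      (\<lambda>j. (\<lambda>b. if b then 0 else 1 - \<beta>) \<circ> (\<lambda>\<omega>. \<omega> j)) UNIV"
    by (rule C.indep_vars_compose[OF ind]) auto
  then have 1: "C.indep_vars (\<lambda>_. borel) (coin_innovation \<beta>) UNIV"
    by (simp add: coin_innovation_def[abs_def] o_def)
  have *: "measure (coin_space p) {\<omega> \<in> space (coin_space p). \<omega> j = b} = pmf (bernoulli_pmf p) b"
    for j b
  proof -
    have "measure (coin_space p) {\<omega> \<in> space (coin_space p). \<omega> j = b}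
        = measure (distr (coin_space p) (?B j) (\<lambda>\<omega>. \<omega> j)) {b}"
      by (subst measure_distr) (auto simp: coin_space_def intro!: arg_cong2[where f=measure])
    also have "distr (coin_space p) (?B j) (\<lambda>\<omega>. \<omega> j) = ?B j"
      unfolding coin_space_def by (rule distr_PiM_component) (auto intro: measure_pmf.prob_space_axioms)
    finally show ?thesis by (simp add: measure_pmf_single)
  qed
  have "coin_innovation \<beta> j \<omega> = 0 \<longleftrightarrow> \<omega> j = True" "coin_innovation \<beta> j \<omega> = 1 - \<beta> \<longleftrightarrow> \<omega> j = False"
    for j \<omega>
    using assms by (auto simp: coin_innovation_def)
  then show ?thesis
    unfolding ar1_innovations_def using 1 C.prob_space_axioms assms by (simp only: *) simp
qed

lemma ar1_cdf_eq:
  assumes inn: "ar1_innovations M \<beta> p \<epsilon>" and "0 < \<beta>" "\<beta> < 1" "0 < p" "p < 1"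
  shows "measure M {\<omega> \<in> space M. ar1_process \<beta> \<epsilon> k \<omega> \<le> y} = ar1_cdf \<beta> p y"
proof -
  interpret prob_space M using inn by (simp add: ar1_innovations_def)
  let ?B = "\<lambda>_::int. measure_pmf (bernoulli_pmf p)"
  let ?C = "\<lambda>_::int. count_space (UNIV :: bool set)"
  let ?b = "\<lambda>j \<omega>. \<epsilon> j \<omega> = 0"
  have ind: "indep_vars (\<lambda>_. borel) \<epsilon> UNIV"
    and prob: "\<And>j. prob {\<omega> \<in> space M. \<epsilon> j \<omega> = 0} = p"
      "\<And>j. prob {\<omega> \<in> space M. \<epsilon> j \<omega> = 1 - \<beta>} = 1 - p"
    using inn by (auto simp: ar1_innovations_def)
  have meas[measurable]: "\<epsilon> j \<in> borel_measurable M" for j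
    using ind by (auto simp: indep_vars_def)
  have ind_b: "indep_vars ?C ?b UNIV"
    using indep_vars_compose[OF ind, of "\<lambda>_ x. x = 0" ?C] by (simp add: o_def)
  have law: "distr M (count_space UNIV) (?b j) = measure_pmf (bernoulli_pmf p)" for j
  proof (rule measure_eqI)
    fix A assume "A \<in> sets (distr M (count_space UNIV) (?b j))"
    interpret D: prob_space "distr M (count_space UNIV) (?b j)"
      by (rule prob_space_distr) simp
    have single: "D.prob {c} = pmf (bernoulli_pmf p) c" for c
    proof -
      have "D.prob {c} = prob {\<omega> \<in> space M. (\<epsilon> j \<omega> = 0) = c}"
        by (subst measure_distr) (auto intro!: arg_cong[where f=prob])
      also have "\<dots> = pmf (bernoulli_pmf p) c"
        using prob(1)[of j] prob_neg[of "\<lambda>\<omega>. \<epsilon> j \<omega> = 0"] assms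
        by (cases c) auto
      finally show ?thesis .
    qed
    have "D.prob A = (\<Sum>c\<in>A. D.prob {c})"
      by (rule D.finite_measure_eq_sum_singleton) auto
    also have "\<dots> = measure (bernoulli_pmf p) A"
      by (simp add: single measure_measure_pmf_finite)
    finally show "emeasure (distr M (count_space UNIV) (?b j)) A = emeasure (bernoulli_pmf p) A"
      by (simp add: D.emeasure_eq_measure measure_pmf.emeasure_eq_measure)
  qed simp
  let ?s = "\<lambda>\<omega> j. \<omega> (int k + j)"
  have joint0: "distr M (Pi\<^sub>M UNIV ?C) (\<lambda>\<omega> j. ?b j \<omega>) = coin_space p"
    using ind_b indep_vars_iff_distr_eq_PiM'[of UNIV ?b ?C] 
    by (simp add: law coin_space_def restrict_def)
  have sets_coin: "sets (coin_space p) = sets (Pi\<^sub>M UNIV ?C)"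
    unfolding coin_space_def by (rule sets_PiM_cong) simp_all
  have bm0[measurable]: "(\<lambda>\<omega> j. ?b j \<omega>) \<in> measurable M (Pi\<^sub>M UNIV ?C)"
    by (rule measurable_PiM_single') (auto simp: space_PiM)
  have sm[measurable]: "?s \<in> measurable (Pi\<^sub>M UNIV ?C) (Pi\<^sub>M UNIV ?C)"
    by (rule measurable_PiM_single') (auto simp: space_PiM)
  have "distr M (Pi\<^sub>M UNIV ?C) (\<lambda>\<omega>. ?s (\<lambda>j. ?b j \<omega>))
      = distr (distr M (Pi\<^sub>M UNIV ?C) (\<lambda>\<omega> j. ?b j \<omega>)) (Pi\<^sub>M UNIV ?C) ?s"
    by (subst distr_distr[OF sm bm0]) (simp add: o_def)
  also have "\<dots> = distr (coin_space p) (coin_space p) ?s"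
    unfolding joint0 by (rule distr_cong) (simp_all add: sets_coin)
  also have "\<dots> = coin_space p"
    using distr_PiM_reindex[of UNIV ?B "\<lambda>j. int k + j" UNIV]
    by (simp add: coin_space_def inj_on_def restrict_def measure_pmf.prob_space_axioms)
  finally have joint: "distr M (Pi\<^sub>M UNIV ?C) (\<lambda>\<omega> j. ?b (int k + j) \<omega>) = coin_space p" .
  have ae: "AE \<omega> in M. \<forall>j. \<epsilon> j \<omega> = (if \<epsilon> j \<omega> = 0 then 0 else 1 - \<beta>)"
  proof (subst AE_all_countable, rule allI)
    fix j
    have "prob ({\<omega> \<in> space M. \<epsilon> j \<omega> = 0} \<union> {\<omega> \<in> space M. \<epsilon> j \<omega> = 1 - \<beta>}) = 1"
      using assms prob[of j] by (subst finite_measure_Union) auto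
    then have "AE \<omega> in M. \<omega> \<in> {\<omega> \<in> space M. \<epsilon> j \<omega> = 0} \<union> {\<omega> \<in> space M. \<epsilon> j \<omega> = 1 - \<beta>}"
      by (rule AE_prob_1)
    then show "AE \<omega> in M. \<epsilon> j \<omega> = (if \<epsilon> j \<omega> = 0 then 0 else 1 - \<beta>)"
      by eventually_elim auto
  qed
  have X[measurable]: "ar1_process \<beta> (coin_innovation \<beta>) 0 \<in> borel_measurable (Pi\<^sub>M UNIV ?C)"
    unfolding ar1_process_def[abs_def] coin_innovation_def by measurable
  have bm[measurable]: "(\<lambda>\<omega> j. ?b (int k + j) \<omega>) \<in> measurable M (Pi\<^sub>M UNIV ?C)"
    by (rule measurable_PiM_single') (auto simp: space_PiM)
  have Y[measurable]: "ar1_process \<beta> \<epsilon> k \<in> borel_measurable M"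
    unfolding ar1_process_def[abs_def] by measurable
  have "prob {\<omega> \<in> space M. ar1_process \<beta> \<epsilon> k \<omega> \<le> y}
      = prob {\<omega> \<in> space M. ar1_process \<beta> (coin_innovation \<beta>) 0 (\<lambda>j. ?b (int k + j) \<omega>) \<le> y}"
  proof (rule finite_measure_eq_AE)
    show "AE \<omega> in M. \<omega> \<in> {\<omega> \<in> space M. ar1_process \<beta> \<epsilon> k \<omega> \<le> y} \<longleftrightarrow>
        \<omega> \<in> {\<omega> \<in> space M. ar1_process \<beta> (coin_innovation \<beta>) 0 (\<lambda>j. ?b (int k + j) \<omega>) \<le> y}"
      using ae
    proof eventually_elim
      case (elim \<omega>)
      have "ar1_process \<beta> \<epsilon> k \<omega> = ar1_process \<beta> (coin_innovation \<beta>) 0 (\<lambda>j. ?b (int k + j) \<omega>)"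
        unfolding ar1_process_def coin_innovation_def
        by (intro suminf_cong arg_cong2[where f="(*)"] refl) (use elim in simp)
      then show ?case by simp
    qed
  qed measurable
  also have "\<dots> = measure (distr M (Pi\<^sub>M UNIV ?C) (\<lambda>\<omega> j. ?b (int k + j) \<omega>))
      {\<omega> \<in> space (Pi\<^sub>M UNIV ?C). ar1_process \<beta> (coin_innovation \<beta>) 0 \<omega> \<le> y}"
  proof (subst measure_distr)
    show "{\<omega> \<in> space (Pi\<^sub>M UNIV ?C). ar1_process \<beta> (coin_innovation \<beta>) 0 \<omega> \<le> y} \<in> sets (Pi\<^sub>M UNIV ?C)"
      by measurable
  qed (auto simp: space_PiM intro!: arg_cong[where f=prob] bm)
  also have "\<dots> = ar1_cdf \<beta> p y"
    unfolding joint ar1_cdf_def by (simp add: coin_space_def space_PiM)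
  finally show ?thesis .
qed

text \<open>On the given range of \<open>y\<close>, \<open>ln y\<close> covers a full period, so at most one \<open>\<nu>\<close> satisfies
  \<open>is_nu\<close>.\<close>

definition is_nu :: "real \<Rightarrow> real \<Rightarrow> (real \<Rightarrow> real) \<Rightarrow> bool" where
  "is_nu \<beta> q \<nu> \<longleftrightarrow>
     (\<forall>t. 0 < \<nu> t) \<and> continuous_on UNIV \<nu> \<and> (\<forall>t. \<nu> (t + ln (1 / \<beta>)) = \<nu> t) \<and>
     (\<forall>y. y \<in> (if \<beta> \<le> 1 / 2 then {0<..<1} else {0<..1 / \<beta> - 1}) \<longrightarrow>
        ar1_cdf \<beta> q y = y powr (ln q / ln \<beta>) * \<nu> (ln y))"

definition nu :: "real \<Rightarrow> real \<Rightarrow> real \<Rightarrow> real" where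
  "nu \<beta> q = (THE \<nu>. is_nu \<beta> q \<nu>)"

definition H :: "real \<Rightarrow> real \<Rightarrow> real \<Rightarrow> real" where
  "H \<beta> q x = (if x < 0 then exp (- ((- x) powr (ln q / ln \<beta>) * nu \<beta> q (ln (- x)))) else 1)"

definition k_seq :: "real \<Rightarrow> nat \<Rightarrow> nat" where
  "k_seq q n = nat \<lfloor>(1 / q) ^ n\<rfloor>"

text \<open>For \<open>0 < q < 1\<close> the sequence \<open>k_seq q\<close> is nondecreasing and unbounded, so the \<open>m\<close> below exists and
  is unique whenever \<open>n \<ge> k_seq q 1\<close>; for smaller \<open>n\<close> the values of \<open>m_seq\<close>, \<open>r_seq\<close> and \<open>a_seq\<close>
  carry no meaning.\<close>

definition m_seq :: "real \<Rightarrow> nat \<Rightarrow> nat" where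
  "m_seq q n = (THE m. 1 \<le> m \<and> k_seq q m \<le> n \<and> n < k_seq q (m + 1))"

definition r_seq :: "real \<Rightarrow> nat \<Rightarrow> real" where
  "r_seq q n = real n / real (k_seq q (m_seq q n))"

definition a_seq :: "real \<Rightarrow> real \<Rightarrow> nat \<Rightarrow> real" where
  "a_seq \<beta> q n = 1 / \<beta> ^ m_seq q n"

end

theory Submission imports Defs begin

text \<open>
  Up to a null set \<open>1 - X\<close> is the stationary process \<open>Y\<close> with \<open>p\<close> and \<open>q\<close> exchanged, so the event
  says that \<open>Y\<close> stays above a level \<open>u\<close> of order \<open>\<beta> ^ m\<close> up to time \<open>n\<close>. Visits of \<open>Y\<close> below a small
  level \<open>u\<close> come in clusters, and a visit ends exactly when the next innovation is nonzero. Such exits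
  have probability \<open>p F(u)\<close>, which is where the extremal index \<open>p\<close> comes from. With innovations older
  than \<open>2 m\<close> ignored, exits more than \<open>2 m\<close> steps apart are independent, and two exits closer together
  are unlikely, because an exit must be preceded by about \<open>m\<close> zero innovations. So the probability
  \<open>g n\<close> of no exit before time \<open>n\<close> satisfies \<open>g (n + 1) = (1 - p F(u)) g n\<close> up to a negligible error,
  and \<open>g n\<close> is close to \<open>exp (- n p F(u))\<close>.
\<close>

section \<open>Elementary bounds: powers close to exponentials, and heavy atoms\<close>

lemma abs_one_minus_exp_le:
  fixes x :: real
  assumes "0 \<le> x"
  shows "\<bar>(1 - x) - exp (- x)\<bar> \<le> x\<^sup>2"
proof -
  have "exp (- x) * (1 + x) \<le> 1"
  proof -
    have "exp (- x) * (1 + x) \<le> exp (- x) * exp x"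
      using exp_ge_add_one_self[of x] by (intro mult_left_mono) auto
    then show ?thesis by (simp flip: exp_add)
  qed
  \<comment> \<open>The product equals \<open>1 + x ^ 3\<close>.\<close>
  moreover have "1 \<le> (1 - x + x\<^sup>2) * (1 + x)"
    using assms by (simp add: algebra_simps power2_eq_square)
  ultimately have "exp (- x) * (1 + x) \<le> (1 - x + x\<^sup>2) * (1 + x)" by linarith
  then have "exp (- x) \<le> 1 - x + x\<^sup>2"
    using assms by (simp add: mult_le_cancel_right)
  then show ?thesis using exp_ge_add_one_self[of "- x"] by simp
qed

text \<open>Both bases lie in \<open>[0, 1]\<close>, so their \<open>n\<close>-th powers differ by
  at most \<open>n\<close> times the difference of the bases, hence by at most
  \<open>(n * x) * x\<close>, which tends to 0.\<close>

lemma tendsto_power_exp: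
  fixes x :: "nat \<Rightarrow> real" and n :: "nat \<Rightarrow> nat"
  assumes nx: "(\<lambda>i. real (n i) * x i) \<longlonglongrightarrow> c" and x: "x \<longlonglongrightarrow> 0"
    and bounds: "\<And>i. 0 \<le> x i" "\<And>i. x i \<le> 1"
  shows "(\<lambda>i. (1 - x i) ^ n i) \<longlonglongrightarrow> exp (- c)"
proof -
  have "(\<lambda>i. (1 - x i) ^ n i - exp (- x i) ^ n i) \<longlonglongrightarrow> 0"
  proof (rule Lim_null_comparison)
    show "(\<lambda>i. real (n i) * x i * x i) \<longlonglongrightarrow> 0" using tendsto_mult[OF nx x] by simp
    have "norm ((1 - x i) ^ n i - exp (- x i) ^ n i) \<le> real (n i) * x i * x i" for i
    proof -
      have "norm ((1 - x i) ^ n i - exp (- x i) ^ n i) \<le> real (n i) * norm ((1 - x i) - exp (- x i))"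
        using bounds[of i] by (intro norm_power_diff) auto
      also have "\<dots> \<le> real (n i) * (x i)\<^sup>2"
        using abs_one_minus_exp_le[OF bounds(1)[of i]] by (intro mult_left_mono) auto
      finally show ?thesis by (simp add: power2_eq_square mult_ac)
    qed
    then show "\<forall>\<^sub>F i in sequentially. norm ((1 - x i) ^ n i - exp (- x i) ^ n i) \<le> real (n i) * x i * x i"
      by simp
  qed
  moreover have "(\<lambda>i. exp (- x i) ^ n i) \<longlonglongrightarrow> exp (- c)"
  proof -
    have "(\<lambda>i. exp (- (real (n i) * x i))) \<longlonglongrightarrow> exp (- c)" by (intro tendsto_intros nx)
    then show ?thesis by (simp flip: exp_of_nat_mult)
  qed
  ultimately show ?thesis by (rule Lim_transform[rotated])
qed

text \<open>Sufficiently many points of mass at least \<open>t\<close> would together exceed the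
  total mass. This provides a heaviest atom in the continuity proof below.\<close>

lemma (in finite_measure) finite_heavy_singletons:
  assumes "0 < t" and "\<And>x. {x} \<in> sets M"
  shows "finite {x. t \<le> measure M {x}}"
proof (rule ccontr)
  assume "infinite {x. t \<le> measure M {x}}"
  obtain n :: nat where n: "measure M (space M) < real n * t"
    using reals_Archimedean3[OF assms(1)] by blast
  obtain T where T: "finite T" "card T = n" "T \<subseteq> {x. t \<le> measure M {x}}"
    using infinite_arbitrarily_large[OF \<open>infinite _\<close>] by blast
  have "real n * t \<le> (\<Sum>x\<in>T. measure M {x})"
    using sum_bounded_below[of T t "\<lambda>x. measure M {x}"] T by auto
  also have "\<dots> = measure M T"
    using assms T by (intro finite_measure_eq_sum_singleton[symmetric]) auto
  also have "\<dots> \<le> measure M (space M)" by (rule bounded_measure)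
  finally show False using n by simp
qed

section \<open>The process with two-valued innovations\<close>

text \<open>Here \<open>q\<close> is the probability of a zero innovation, so this is the setting
  after \<open>p\<close> and \<open>q\<close> have been exchanged. Two values are required at every
  \<open>\<omega>\<close>, which keeps null sets out of the pathwise inequalities.\<close>

locale ar1 = prob_space +
  fixes \<beta> q :: real and \<delta> :: "int \<Rightarrow> 'a \<Rightarrow> real"
  assumes \<beta>: "0 < \<beta>" "\<beta> < 1" and q: "0 < q" "q < 1"
    and innovations: "ar1_innovations M \<beta> q \<delta>"
    and two_valued: "\<delta> j \<omega> \<in> {0, 1 - \<beta>}"
begin

abbreviation Y :: "nat \<Rightarrow> 'a \<Rightarrow> real" where "Y \<equiv> ar1_process \<beta> \<delta>"

abbreviation F :: "real \<Rightarrow> real" where "F \<equiv> ar1_cdf \<beta> q"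

text \<open>The sigma-algebra generated by the innovations with index in \<open>A\<close>. As a
  pullback from a product it fits \<open>indep_var_restrict\<close>, so that independence of events
  reduces to disjointness of index sets.\<close>

definition sigma_fam :: "int set \<Rightarrow> 'a measure" where
  "sigma_fam A = vimage_algebra (space M) (\<lambda>\<omega>. \<lambda>i\<in>A. \<delta> i \<omega>) (Pi\<^sub>M A (\<lambda>_. borel))"

lemma space_sigma_fam [simp]: "space (sigma_fam A) = space M"
  by (simp add: sigma_fam_def)

lemma indep_innovations: "indep_vars (\<lambda>_. borel) \<delta> UNIV"
  and prob_innovation_eq_0: "prob {\<omega> \<in> space M. \<delta> j \<omega> = 0} = q"
  and prob_innovation_eq_1: "prob {\<omega> \<in> space M. \<delta> j \<omega> = 1 - \<beta>} = 1 - q"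
  using innovations by (auto simp: ar1_innovations_def)

lemma innovation_nonneg: "0 \<le> \<delta> j \<omega>"
  and innovation_le: "\<delta> j \<omega> \<le> 1 - \<beta>"
  and innovation_neq_0: "\<delta> j \<omega> \<noteq> 0 \<longleftrightarrow> \<delta> j \<omega> = 1 - \<beta>"
  using two_valued[of j \<omega>] \<beta> by auto

lemma measurable_innovation [measurable]: "\<delta> j \<in> borel_measurable M"
  using indep_innovations by (auto simp: indep_vars_def)

lemma measurable_innovation_sigma_fam: "i \<in> A \<Longrightarrow> \<delta> i \<in> borel_measurable (sigma_fam A)"
proof -
  assume i: "i \<in> A"
  have "(\<lambda>\<omega>. \<lambda>i\<in>A. \<delta> i \<omega>) \<in> measurable (sigma_fam A) (Pi\<^sub>M A (\<lambda>_. borel))"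
    unfolding sigma_fam_def by (rule measurable_vimage_algebra1) (auto simp: space_PiM)
  from measurable_compose[OF this measurable_component_singleton[OF i]] i
  show ?thesis by (simp add: restrict_def)
qed

lemma sets_sigma_fam: "S \<in> sets (sigma_fam A) \<longleftrightarrow>
    (\<exists>B\<in>sets (Pi\<^sub>M A (\<lambda>_. borel)). S = (\<lambda>\<omega>. \<lambda>i\<in>A. \<delta> i \<omega>) -` B \<inter> space M)"
  unfolding sigma_fam_def by (subst sets_vimage_algebra2) (auto simp: space_PiM)

lemma sigma_fam_sets_M: "S \<in> sets (sigma_fam A) \<Longrightarrow> S \<in> sets M"
proof -
  have "(\<lambda>\<omega>. \<lambda>i\<in>A. \<delta> i \<omega>) \<in> measurable M (Pi\<^sub>M A (\<lambda>_. borel))"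
    by (rule measurable_restrict) simp
  then show "S \<in> sets (sigma_fam A) \<Longrightarrow> S \<in> sets M"
    by (auto simp: sets_sigma_fam intro: measurable_sets)
qed

lemma prob_Int_sigma_fam:
  assumes "S \<in> sets (sigma_fam A)" "T \<in> sets (sigma_fam B)" "A \<inter> B = {}"
  shows "prob (S \<inter> T) = prob S * prob T"
proof -
  obtain S' T' where S': "S' \<in> sets (Pi\<^sub>M A (\<lambda>_. borel))" "S = (\<lambda>\<omega>. \<lambda>i\<in>A. \<delta> i \<omega>) -` S' \<inter> space M"
    and T': "T' \<in> sets (Pi\<^sub>M B (\<lambda>_. borel))" "T = (\<lambda>\<omega>. \<lambda>i\<in>B. \<delta> i \<omega>) -` T' \<inter> space M"
    using assms by (auto simp: sets_sigma_fam)
  have "prob ((\<lambda>\<omega>. (\<lambda>i\<in>A. \<delta> i \<omega>, \<lambda>i\<in>B. \<delta> i \<omega>)) -` (S' \<times> T') \<inter> space M) = prob S * prob T"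
    unfolding S'(2) T'(2)
    by (rule indep_varD[OF indep_var_restrict[OF indep_innovations assms(3)]]) (simp_all add: S' T')
  moreover have "(\<lambda>\<omega>. (\<lambda>i\<in>A. \<delta> i \<omega>, \<lambda>i\<in>B. \<delta> i \<omega>)) -` (S' \<times> T') \<inter> space M = S \<inter> T"
    by (auto simp: S' T')
  ultimately show ?thesis by simp
qed

section \<open>Truncation of the series, and the recursion\<close>

lemma summable_process: "summable (\<lambda>j. \<beta> ^ j * \<delta> (k - int j) \<omega>)"
proof (rule summable_comparison_test')
  show "summable (\<lambda>j. \<beta> ^ j * (1 - \<beta>))"
    using \<beta> by (intro summable_mult2 summable_geometric) simp
  show "norm (\<beta> ^ j * \<delta> (k - int j) \<omega>) \<le> \<beta> ^ j * (1 - \<beta>)" for j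
    using \<beta> innovation_nonneg[of "k - int j" \<omega>] innovation_le[of "k - int j" \<omega>] by (simp add: mult_left_mono)
qed

text \<open>Keeping only the \<open>L\<close> most recent innovations gives finite memory, which
  later makes exits far apart independent.\<close>

definition Z :: "nat \<Rightarrow> nat \<Rightarrow> 'a \<Rightarrow> real" where
  "Z L k \<omega> = (\<Sum>j<L. \<beta> ^ j * \<delta> (int k - int j) \<omega>)"

lemma process_ge_Z: "Z L k \<omega> \<le> Y k \<omega>"
  unfolding Z_def ar1_process_def
  using \<beta> innovation_nonneg by (intro sum_le_suminf summable_process) auto

lemma process_nonneg: "0 \<le> Y k \<omega>"
  using process_ge_Z[of 0 k \<omega>] by (simp add: Z_def)

text \<open>The neglected tail is at most \<open>\<beta> ^ L\<close> times the sum of all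
  \<open>\<beta> ^ j * (1 - \<beta>)\<close>, which is 1.\<close>

lemma process_le_Z: "Y k \<omega> \<le> Z L k \<omega> + \<beta> ^ L"
proof -
  have geo: "(\<lambda>j. \<beta> ^ j) sums (1 / (1 - \<beta>))" using \<beta> by (intro geometric_sums) simp
  have s: "summable (\<lambda>j. \<beta> ^ (j + L) * \<delta> (int k - int (j + L)) \<omega>)"
    using summable_ignore_initial_segment[OF summable_process[of "int k" \<omega>], of L] .
  have "Y k \<omega> = (\<Sum>j. \<beta> ^ (j + L) * \<delta> (int k - int (j + L)) \<omega>) + Z L k \<omega>"
    using suminf_split_initial_segment[OF summable_process[of "int k" \<omega>], of L]
    unfolding Z_def ar1_process_def .
  also have "(\<Sum>j. \<beta> ^ (j + L) * \<delta> (int k - int (j + L)) \<omega>) \<le> (\<Sum>j. \<beta> ^ L * (1 - \<beta>) * \<beta> ^ j)"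
  proof (rule suminf_le[OF _ s])
    show "summable (\<lambda>j. \<beta> ^ L * (1 - \<beta>) * \<beta> ^ j)"
      using geo by (intro summable_mult) (simp add: sums_iff)
    show "\<beta> ^ (j + L) * \<delta> (int k - int (j + L)) \<omega> \<le> \<beta> ^ L * (1 - \<beta>) * \<beta> ^ j" for j
    proof -
      have "\<beta> ^ (j + L) * \<delta> (int k - int (j + L)) \<omega> \<le> \<beta> ^ (j + L) * (1 - \<beta>)"
        using \<beta> innovation_le by (intro mult_left_mono) auto
      then show ?thesis by (simp add: power_add mult_ac)
    qed
  qed
  also have "\<dots> = \<beta> ^ L"
    using sums_mult[OF geo, of "\<beta> ^ L * (1 - \<beta>)"] \<beta> by (simp add: sums_iff)
  finally show ?thesis by simp
qed

lemma process_le_1: "Y k \<omega> \<le> 1"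
  using process_le_Z[of k \<omega> 0] by (simp add: Z_def)

lemma process_Suc: "Y (Suc k) \<omega> = \<beta> * Y k \<omega> + \<delta> (int k + 1) \<omega>"
proof -
  have "Y (Suc k) \<omega> = (\<Sum>j. \<beta> ^ Suc j * \<delta> (int (Suc k) - int (Suc j)) \<omega>) + \<delta> (int k + 1) \<omega>"
    unfolding ar1_process_def
    using suminf_split_head[OF summable_process, of "int (Suc k)" \<omega>] by (simp add: algebra_simps)
  also have "(\<Sum>j. \<beta> ^ Suc j * \<delta> (int (Suc k) - int (Suc j)) \<omega>) = \<beta> * Y k \<omega>"
    unfolding ar1_process_def
    using suminf_mult[OF summable_process[of "int k" \<omega>], of \<beta>] by (simp add: mult_ac)
  finally show ?thesis .
qed

lemma measurable_process_sigma_fam: "Y k \<in> borel_measurable (sigma_fam {..int k})"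
proof -
  have [measurable]: "\<delta> (int k - int j) \<in> borel_measurable (sigma_fam {..int k})" for j
    by (rule measurable_innovation_sigma_fam) simp
  show ?thesis unfolding ar1_process_def[abs_def] by measurable
qed

lemma measurable_process [measurable]: "Y k \<in> borel_measurable M"
  unfolding ar1_process_def[abs_def] by measurable

section \<open>Stationarity and self-similarity of the marginal law\<close>

lemma prob_process_le: "prob {\<omega> \<in> space M. Y k \<omega> \<le> y} = F y"
  using ar1_cdf_eq[OF innovations] \<beta> q by simp

abbreviation law :: "real measure" where "law \<equiv> distr M borel (Y 0)"

lemma real_distribution_process: "real_distribution (distr M borel (Y k))"
  by (rule real_distribution_distr) simp

lemma cdf_process: "cdf (distr M borel (Y k)) y = F y"
  unfolding cdf_def
  by (subst measure_distr) (auto simp: prob_process_le[of k, symmetric] intro!: arg_cong[where f=prob])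

text \<open>The distribution function given by \<open>ar1_cdf_eq\<close> does not depend on
  \<open>k\<close>, and it determines the law.\<close>

lemma distr_process: "distr M borel (Y k) = law"
  by (rule cdf_unique[OF real_distribution_process real_distribution_process])
     (simp add: fun_eq_iff cdf_process)

lemma prob_process: "B \<in> sets borel \<Longrightarrow> prob {\<omega> \<in> space M. Y k \<omega> \<in> B} = measure law B"
proof -
  assume [measurable]: "B \<in> sets borel"
  have "prob {\<omega> \<in> space M. Y k \<omega> \<in> B} = measure (distr M borel (Y k)) B"
    by (subst measure_distr) (auto intro!: arg_cong[where f=prob])
  then show ?thesis by (simp only: distr_process[of k])
qed

text \<open>Condition on \<open>\<delta> 1\<close> in
  \<open>Y 1 = \<beta> * Y 0 + \<delta> 1\<close>: it is independent of \<open>Y 0\<close>, and by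
  stationarity \<open>Y 1\<close> has the law of \<open>Y 0\<close>.\<close>

lemma measure_law:
  assumes [measurable]: "B \<in> sets borel"
  shows "measure law B = q * measure law {y. \<beta> * y \<in> B} + (1 - q) * measure law {y. \<beta> * y + (1 - \<beta>) \<in> B}"
proof -
  note [measurable] = measurable_process_sigma_fam[of 0]
  have B0: "{y. \<beta> * y \<in> B} \<in> sets borel" and B1: "{y. \<beta> * y + (1 - \<beta>) \<in> B} \<in> sets borel"
    by measurable
  have [measurable]: "\<delta> 1 \<in> borel_measurable (sigma_fam {1})"
    by (rule measurable_innovation_sigma_fam) simp
  define A0 where "A0 = {\<omega> \<in> space M. Y 0 \<omega> \<in> {y. \<beta> * y \<in> B}}"
  define A1 where "A1 = {\<omega> \<in> space M. Y 0 \<omega> \<in> {y. \<beta> * y + (1 - \<beta>) \<in> B}}"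
  define D0 where "D0 = {\<omega> \<in> space M. \<delta> 1 \<omega> = 0}"
  define D1 where "D1 = {\<omega> \<in> space M. \<delta> 1 \<omega> = 1 - \<beta>}"
  have A: "A0 \<in> sets (sigma_fam {..int 0})" "A1 \<in> sets (sigma_fam {..int 0})"
  proof -
    have "{\<omega> \<in> space (sigma_fam {..int 0}). Y 0 \<omega> \<in> {y. \<beta> * y \<in> B}} \<in> sets (sigma_fam {..int 0})"
      "{\<omega> \<in> space (sigma_fam {..int 0}). Y 0 \<omega> \<in> {y. \<beta> * y + (1 - \<beta>) \<in> B}} \<in> sets (sigma_fam {..int 0})"
      by measurable
    then show "A0 \<in> sets (sigma_fam {..int 0})" "A1 \<in> sets (sigma_fam {..int 0})"
      by (simp_all add: A0_def A1_def)
  qed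
  have D: "D0 \<in> sets (sigma_fam {1})" "D1 \<in> sets (sigma_fam {1})"
  proof -
    have "{\<omega> \<in> space (sigma_fam {1}). \<delta> 1 \<omega> = 0} \<in> sets (sigma_fam {1})"
      "{\<omega> \<in> space (sigma_fam {1}). \<delta> 1 \<omega> = 1 - \<beta>} \<in> sets (sigma_fam {1})"
      by measurable
    then show "D0 \<in> sets (sigma_fam {1})" "D1 \<in> sets (sigma_fam {1})"
      by (simp_all add: D0_def D1_def)
  qed
  have "measure law B = prob {\<omega> \<in> space M. Y 1 \<omega> \<in> B}" by (rule prob_process[symmetric]) fact
  also have "{\<omega> \<in> space M. Y 1 \<omega> \<in> B} = (A0 \<inter> D0) \<union> (A1 \<inter> D1)"
  proof -
    have "Y 1 \<omega> \<in> B \<longleftrightarrow> \<beta> * Y 0 \<omega> \<in> B \<and> \<delta> 1 \<omega> = 0 \<or> \<beta> * Y 0 \<omega> + (1 - \<beta>) \<in> B \<and> \<delta> 1 \<omega> = 1 - \<beta>" for \<omega>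
    proof (cases "\<delta> 1 \<omega> = 0")
      case False
      then show ?thesis using process_Suc[of 0 \<omega>] innovation_neq_0[of 1 \<omega>] \<beta> by simp
    qed (use process_Suc[of 0 \<omega>] \<beta> in simp)
    then show ?thesis unfolding A0_def A1_def D0_def D1_def mem_Collect_eq by auto
  qed
  also have "prob \<dots> = prob (A0 \<inter> D0) + prob (A1 \<inter> D1)"
  proof (rule finite_measure_Union)
    show "A0 \<inter> D0 \<in> events" "A1 \<inter> D1 \<in> events"
      using A D by (blast intro: sigma_fam_sets_M)+
    have "D0 \<inter> D1 = {}" using \<beta> by (auto simp: D0_def D1_def)
    then show "(A0 \<inter> D0) \<inter> (A1 \<inter> D1) = {}" by blast
  qed
  also have "\<dots> = prob A0 * prob D0 + prob A1 * prob D1"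
    using prob_Int_sigma_fam[OF A(1) D(1)] prob_Int_sigma_fam[OF A(2) D(2)] by simp
  also have "prob A0 = measure law {y. \<beta> * y \<in> B}" unfolding A0_def by (rule prob_process[OF B0])
  also have "prob A1 = measure law {y. \<beta> * y + (1 - \<beta>) \<in> B}" unfolding A1_def by (rule prob_process[OF B1])
  finally show ?thesis
    by (simp add: D0_def D1_def prob_innovation_eq_0 prob_innovation_eq_1 mult_ac)
qed

section \<open>Continuity and scaling of the marginal law\<close>

text \<open>The set of heaviest atoms would be finite and mapped into itself by \<open>y \<mapsto> y / \<beta>\<close> and
  \<open>y \<mapsto> (y - (1 - \<beta>)) / \<beta>\<close>; its maximum contradicts the first map or its minimum the second.\<close>

lemma measure_law_singleton: "measure law {y} = 0"
proof (rule ccontr)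
  assume "measure law {y} \<noteq> 0"
  interpret L: real_distribution law by (rule real_distribution_process)
  define f where "f y = measure law {y}" for y
  have pos: "0 < f y" using \<open>measure law {y} \<noteq> 0\<close> by (simp add: f_def zero_less_measure_iff)
  define S where "S = {z. f y \<le> f z}"
  have S: "finite S" "y \<in> S"
    unfolding S_def f_def using pos
    by (intro L.finite_heavy_singletons) (auto simp: f_def)
  define a where "a = Max (f ` S)"
  have le: "f z \<le> a" for z
  proof (cases "z \<in> S")
    case False
    then have "f z \<le> f y" by (simp add: S_def)
    also have "\<dots> \<le> a" using S by (simp add: a_def)
    finally show ?thesis .
  qed (use S in \<open>simp add: a_def\<close>)
  define T where "T = {z. f z = a}"
  have "a \<in> f ` S" unfolding a_def using S by (intro Max_in) auto
  then have ne: "T \<noteq> {}" by (auto simp: T_def)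
  have fy: "f y \<le> a" using le .
  have fin: "finite T"
    by (rule finite_subset[OF _ S(1)]) (use fy in \<open>auto simp: T_def S_def\<close>)
  have step: "z / \<beta> \<in> T" "(z - (1 - \<beta>)) / \<beta> \<in> T" if "z \<in> T" for z
  proof -
    have "{y. \<beta> * y \<in> {z}} = {z / \<beta>}" "{y. \<beta> * y + (1 - \<beta>) \<in> {z}} = {(z - (1 - \<beta>)) / \<beta>}"
      using \<beta> by (auto simp: field_simps)
    then have "f z = q * f (z / \<beta>) + (1 - q) * f ((z - (1 - \<beta>)) / \<beta>)"
      using measure_law[of "{z}"] by (simp add: f_def)
    \<comment> \<open>The maximal mass \<open>a\<close> is a weighted mean, with positive weights,
      of two masses that are at most \<open>a\<close>; so both equal \<open>a\<close>.\<close>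
    then have "q * (a - f (z / \<beta>)) + (1 - q) * (a - f ((z - (1 - \<beta>)) / \<beta>)) = 0"
      using that by (simp add: T_def algebra_simps)
    moreover have "0 \<le> q * (a - f (z / \<beta>))" "0 \<le> (1 - q) * (a - f ((z - (1 - \<beta>)) / \<beta>))"
      using le q by simp_all
    ultimately have "q * (a - f (z / \<beta>)) = 0" "(1 - q) * (a - f ((z - (1 - \<beta>)) / \<beta>)) = 0"
      by linarith+
    then show "z / \<beta> \<in> T" "(z - (1 - \<beta>)) / \<beta> \<in> T" using q by (auto simp: T_def)
  qed
  have "Max T / \<beta> \<le> Max T" using step(1)[OF Max_in[OF fin ne]] fin by simp
  then have "Max T \<le> 0" using \<beta> mult_le_cancel_left1[of "Max T" \<beta>] by (simp add: field_simps mult_le_cancel_left1)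
  then have m: "Min T \<le> 0" using Min_le_iff[OF fin ne, of 0] Max_in[OF fin ne] by auto
  \<comment> \<open>This rearranges to \<open>Min T \<ge> 1\<close>, against
    \<open>Min T \<le> 0\<close>.\<close>
  have "Min T \<le> (Min T - (1 - \<beta>)) / \<beta>" using step(2)[OF Min_in[OF fin ne]] fin by simp
  then have "0 \<le> (1 - \<beta>) * (Min T - 1)" using \<beta> by (simp add: field_simps)
  then show False using m \<beta> by (simp add: zero_le_mult_iff)
qed

text \<open>Without atoms, strict and non-strict levels have the same probability. Exits use
  \<open>Y k \<omega> < u\<close>, the negation of \<open>u \<le> Y k \<omega>\<close>.\<close>

lemma prob_process_less: "prob {\<omega> \<in> space M. Y k \<omega> < y} = F y"
proof -
  interpret L: real_distribution law by (rule real_distribution_process)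
  have "F y = measure law ({..<y} \<union> {y})"
    using cdf_process[of 0 y] by (simp add: cdf_def ivl_disj_un_singleton(2) del: Un_insert_right)
  also have "\<dots> = measure law {..<y}"
    by (subst L.finite_measure_Union) (auto simp: measure_law_singleton)
  also have "\<dots> = prob {\<omega> \<in> space M. Y k \<omega> < y}"
    using prob_process[of "{..<y}" k] by simp
  finally show ?thesis by simp
qed

lemma isCont_F: "isCont F y"
proof -
  interpret L: real_distribution law by (rule real_distribution_process)
  have "cdf law = F" using cdf_process by (simp add: fun_eq_iff)
  then show ?thesis using L.isCont_cdf[of y] measure_law_singleton by simp
qed

lemma F_mono: "x \<le> y \<Longrightarrow> F x \<le> F y"
  unfolding prob_process_le[of 0, symmetric] by (rule finite_measure_mono) auto

lemma F_nonneg: "0 \<le> F y" and F_le_1: "F y \<le> 1"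
  unfolding prob_process_le[of 0, symmetric] by simp_all

text \<open>The absence of atoms settles \<open>y = 0\<close>: a nonnegative process is never
  strictly below such a \<open>y\<close>.\<close>

lemma F_eq_0: "y \<le> 0 \<Longrightarrow> F y = 0"
proof -
  assume "y \<le> 0"
  then have "{\<omega> \<in> space M. Y 0 \<omega> < y} = {}"
  proof -
    have "\<not> Y 0 \<omega> < y" for \<omega> using process_nonneg[of 0 \<omega>] \<open>y \<le> 0\<close> by linarith
    then show ?thesis by simp
  qed
  then show ?thesis using prob_process_less[of 0 y] by (metis measure_empty)
qed

lemma F_eq_1: "1 \<le> y \<Longrightarrow> F y = 1"
proof -
  assume "1 \<le> y"
  then have "Y 0 \<omega> \<le> y" for \<omega> using process_le_1[of 0 \<omega>] by linarith
  then have "{\<omega> \<in> space M. Y 0 \<omega> \<le> y} = space M" by simp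
  then show ?thesis using prob_process_le[of 0 y] by (simp add: prob_space)
qed

section \<open>Functional equation of the distribution function\<close>

lemma F_mult: "F (\<beta> * y) = q * F y + (1 - q) * F (y - (1 / \<beta> - 1))"
proof -
  \<comment> \<open>A nonzero innovation shifts the level by
    \<open>(1 - \<beta>) / \<beta> = 1 / \<beta> - 1\<close>.\<close>
  have *: "{z. \<beta> * z \<in> {..\<beta> * y}} = {..y}" "{z. \<beta> * z + (1 - \<beta>) \<in> {..\<beta> * y}} = {..y - (1 / \<beta> - 1)}"
    using \<beta> by (auto simp: field_simps)
  have "F (\<beta> * y) = measure law {..\<beta> * y}"
    using cdf_process[of 0] by (simp add: cdf_def)
  also have "\<dots> = q * measure law {..y} + (1 - q) * measure law {..y - (1 / \<beta> - 1)}"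
    using measure_law[of "{..\<beta> * y}"] by (simp only: * sets.sets_into_space) simp
  finally show ?thesis using cdf_process[of 0] by (simp add: cdf_def)
qed

text \<open>Below the cutoff \<open>1 / \<beta> - 1\<close> the branch with a nonzero innovation has
  a nonpositive level and hence probability 0, which leaves exact scaling.\<close>

lemma F_scale: "y \<le> 1 / \<beta> - 1 \<Longrightarrow> F (\<beta> * y) = q * F y"
  using F_mult[of y] F_eq_0[of "y - (1 / \<beta> - 1)"] by simp

lemma F_scale_power: "0 \<le> y \<Longrightarrow> y \<le> 1 / \<beta> - 1 \<Longrightarrow> F (\<beta> ^ n * y) = q ^ n * F y"
proof (induction n)
  case (Suc n)
  have "\<beta> ^ n * y \<le> y" using \<beta> Suc by (intro mult_left_le_one_le) (auto simp: power_le_one)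
  then have "F (\<beta> * (\<beta> ^ n * y)) = q * F (\<beta> ^ n * y)" using Suc by (intro F_scale) auto
  then show ?case using Suc by (simp add: mult_ac)
qed simp

text \<open>Dropping the second branch of \<open>F_mult\<close> and iterating from
  \<open>F 1 = 1\<close> gives \<open>F (\<beta> ^ n) \<ge> q ^ n\<close>.\<close>

lemma F_pos: "0 < y \<Longrightarrow> 0 < F y"
proof -
  assume "0 < y"
  obtain n where n: "\<beta> ^ n < y" using real_arch_pow_inv[OF \<open>0 < y\<close> \<beta>(2)] by blast
  have "q ^ n \<le> F (\<beta> ^ n)" for n
  proof (induction n)
    case (Suc n)
    have "q * q ^ n \<le> q * F (\<beta> ^ n)" using Suc q by simp
    also have "\<dots> \<le> F (\<beta> * \<beta> ^ n)" using F_mult[of "\<beta> ^ n"] F_nonneg q by simp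
    finally show ?case by simp
  qed (simp add: F_eq_1)
  then have "0 < F (\<beta> ^ n)" using q by (meson less_le_trans zero_less_power)
  then show ?thesis using F_mono[of "\<beta> ^ n" y] n by linarith
qed

section \<open>Clusters of visits below a level\<close>

definition zero_run :: "nat \<Rightarrow> nat \<Rightarrow> 'a set" where
  "zero_run J n = {\<omega> \<in> space M. \<forall>j<J. \<delta> (int n - int j) \<omega> = 0}"

text \<open>The end of a visit below \<open>u\<close>, read off the truncated process so that only
  innovations with index in \<open>{k - L<..k + 1}\<close> matter.\<close>

definition trunc_exit :: "nat \<Rightarrow> real \<Rightarrow> nat \<Rightarrow> 'a set" where
  "trunc_exit L u k = {\<omega> \<in> space M. Z L k \<omega> < u \<and> \<delta> (int k + 1) \<omega> \<noteq> 0}"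

definition avoid :: "nat \<Rightarrow> real \<Rightarrow> nat \<Rightarrow> 'a set" where
  "avoid L u n = {\<omega> \<in> space M. \<forall>k<n. \<omega> \<notin> trunc_exit L u k}"

lemma sets_innovation_eq_0:
  "i \<in> A \<Longrightarrow> {\<omega> \<in> space M. \<delta> i \<omega> = 0} \<in> sets (sigma_fam A)"
  "i \<in> A \<Longrightarrow> {\<omega> \<in> space M. \<delta> i \<omega> \<noteq> 0} \<in> sets (sigma_fam A)"
proof -
  assume i: "i \<in> A"
  note [measurable] = measurable_innovation_sigma_fam[OF i]
  have "{\<omega> \<in> space (sigma_fam A). \<delta> i \<omega> = 0} \<in> sets (sigma_fam A)"
    "{\<omega> \<in> space (sigma_fam A). \<delta> i \<omega> \<noteq> 0} \<in> sets (sigma_fam A)" by measurable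
  then show "{\<omega> \<in> space M. \<delta> i \<omega> = 0} \<in> sets (sigma_fam A)"
    "{\<omega> \<in> space M. \<delta> i \<omega> \<noteq> 0} \<in> sets (sigma_fam A)" by simp_all
qed

lemma sets_zero_run:
  assumes "{int n - int J<..int n} \<subseteq> A"
  shows "zero_run J n \<in> sets (sigma_fam A)"
proof -
  have [measurable]: "\<delta> (int n - int j) \<in> borel_measurable (sigma_fam A)" if "j \<in> {..<J}" for j
    using that assms by (intro measurable_innovation_sigma_fam) auto
  have "{\<omega> \<in> space (sigma_fam A). \<forall>j\<in>{..<J}. \<delta> (int n - int j) \<omega> = 0} \<in> sets (sigma_fam A)"
    by measurable
  then show ?thesis by (simp only: space_sigma_fam zero_run_def Ball_def lessThan_iff)
qed

lemma prob_zero_run: "prob (zero_run J n) = q ^ J"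
proof (induction J)
  case 0
  then show ?case by (simp add: zero_run_def prob_space)
next
  case (Suc J)
  have "zero_run (Suc J) n = zero_run J n \<inter> {\<omega> \<in> space M. \<delta> (int n - int J) \<omega> = 0}"
    by (auto simp: zero_run_def less_Suc_eq)
  also have "prob \<dots> = prob (zero_run J n) * prob {\<omega> \<in> space M. \<delta> (int n - int J) \<omega> = 0}"
    by (rule prob_Int_sigma_fam[OF sets_zero_run[OF subset_refl]
          sets_innovation_eq_0(1)[of _ "{int n - int J}"]]) auto
  finally show ?case using Suc by (simp add: prob_innovation_eq_0)
qed

lemma sets_trunc_exit:
  assumes "{int k - int L<..int k + 1} \<subseteq> A"
  shows "trunc_exit L u k \<in> sets (sigma_fam A)"
proof -
  have "\<delta> (int k - int j) \<in> borel_measurable (sigma_fam A)" if "j \<in> {..<L}" for j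
    using that assms by (intro measurable_innovation_sigma_fam) auto
  then have [measurable]: "Z L k \<in> borel_measurable (sigma_fam A)"
    unfolding Z_def[abs_def]
    by (intro borel_measurable_sum borel_measurable_times borel_measurable_const)
  have [measurable]: "\<delta> (int k + 1) \<in> borel_measurable (sigma_fam A)"
    using assms by (intro measurable_innovation_sigma_fam) auto
  have "{\<omega> \<in> space (sigma_fam A). Z L k \<omega> < u \<and> \<delta> (int k + 1) \<omega> \<noteq> 0} \<in> sets (sigma_fam A)"
    by measurable
  then show ?thesis by (simp only: space_sigma_fam trunc_exit_def)
qed

lemma sets_avoid:
  assumes "{..int n} \<subseteq> A"
  shows "avoid L u n \<in> sets (sigma_fam A)"
proof -
  \<comment> \<open>An exit at \<open>k\<close> looks one step ahead, to index
    \<open>k + 1 \<le> n\<close>.\<close>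
  have *: "trunc_exit L u k \<in> sets (sigma_fam A)" if "k < n" for k
    using that assms by (intro sets_trunc_exit) auto
  have "avoid L u n = space (sigma_fam A) - (\<Union>k\<in>{..<n}. trunc_exit L u k)"
    by (auto simp: avoid_def)
  also have "\<dots> \<in> sets (sigma_fam A)" using * by (intro sets.Diff sets.top sets.finite_UN) auto
  finally show ?thesis .
qed

lemma events_trunc_exit [measurable]: "trunc_exit L u k \<in> events"
  and events_avoid [measurable]: "avoid L u n \<in> events"
  and events_zero_run [measurable]: "zero_run J n \<in> events"
  by (rule sigma_fam_sets_M, rule sets_trunc_exit sets_avoid sets_zero_run, rule subset_UNIV)+

lemma avoid_antimono: "m \<le> n \<Longrightarrow> avoid L u n \<subseteq> avoid L u m"
  by (auto simp: avoid_def)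

lemma prob_process_between: "u \<le> v \<Longrightarrow> prob {\<omega> \<in> space M. u \<le> Y k \<omega> \<and> Y k \<omega> < v} = F v - F u"
proof -
  assume "u \<le> v"
  then have "{\<omega> \<in> space M. u \<le> Y k \<omega> \<and> Y k \<omega> < v} = {\<omega> \<in> space M. Y k \<omega> < v} - {\<omega> \<in> space M. Y k \<omega> < u}"
    by auto
  also have "prob \<dots> = F v - F u"
    using \<open>u \<le> v\<close> by (subst finite_measure_Diff) (auto simp: prob_process_less)
  finally show ?thesis .
qed

text \<open>For the process itself, \<open>Y k < u\<close> and a nonzero innovation at
  \<open>k + 1\<close> are independent, which gives \<open>(1 - q) * F u\<close>. Truncation only
  adds paths with \<open>u \<le> Y k < u + \<beta> ^ L\<close>.\<close>

lemma prob_trunc_exit_ge: "(1 - q) * F u \<le> prob (trunc_exit L u k)"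
  and prob_trunc_exit_le: "prob (trunc_exit L u k) \<le> (1 - q) * F u + (F (u + \<beta> ^ L) - F u)"
proof -
  define E where "E = {\<omega> \<in> space M. Y k \<omega> < u} \<inter> {\<omega> \<in> space M. \<delta> (int k + 1) \<omega> \<noteq> 0}"
  have [measurable]: "E \<in> events" by (simp add: E_def)
  note [measurable] = measurable_process_sigma_fam[of k]
  have "{\<omega> \<in> space (sigma_fam {..int k}). Y k \<omega> < u} \<in> sets (sigma_fam {..int k})"
    by measurable
  then have "{\<omega> \<in> space M. Y k \<omega> < u} \<in> sets (sigma_fam {..int k})" by simp
  from prob_Int_sigma_fam[OF this sets_innovation_eq_0(2)[OF singletonI[of "int k + 1"]]]
  have E: "prob E = (1 - q) * F u"
    by (simp add: E_def prob_process_less innovation_neq_0 prob_innovation_eq_1)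
  have "E \<subseteq> trunc_exit L u k"
    using process_ge_Z[of L k] by (auto simp: E_def trunc_exit_def intro: le_less_trans)
  then show "(1 - q) * F u \<le> prob (trunc_exit L u k)"
    unfolding E[symmetric] by (rule finite_measure_mono) simp
  have bL: "0 < \<beta> ^ L" using \<beta> by simp
  have "trunc_exit L u k \<subseteq> E \<union> {\<omega> \<in> space M. u \<le> Y k \<omega> \<and> Y k \<omega> < u + \<beta> ^ L}"
  proof
    fix \<omega> assume \<omega>: "\<omega> \<in> trunc_exit L u k"
    then have "Y k \<omega> < u + \<beta> ^ L" using process_le_Z[of k \<omega> L] by (auto simp: trunc_exit_def)
    with \<omega> show "\<omega> \<in> E \<union> {\<omega> \<in> space M. u \<le> Y k \<omega> \<and> Y k \<omega> < u + \<beta> ^ L}"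
      by (auto simp: E_def trunc_exit_def)
  qed
  then have "prob (trunc_exit L u k) \<le> prob (E \<union> {\<omega> \<in> space M. u \<le> Y k \<omega> \<and> Y k \<omega> < u + \<beta> ^ L})"
    by (rule finite_measure_mono) simp
  also have "\<dots> \<le> prob E + prob {\<omega> \<in> space M. u \<le> Y k \<omega> \<and> Y k \<omega> < u + \<beta> ^ L}"
    by (rule measure_Un_le) simp_all
  finally show "prob (trunc_exit L u k) \<le> (1 - q) * F u + (F (u + \<beta> ^ L) - F u)"
    using prob_process_between[of u "u + \<beta> ^ L" k] bL by (simp add: E)
qed

text \<open>A single nonzero innovation among the last \<open>J\<close> already contributes at least
  \<open>u\<close> to the truncated sum, whose terms are nonnegative.\<close>

lemma trunc_exit_subset_zero_run:
  assumes "J \<le> L" and "\<And>j. j < J \<Longrightarrow> u \<le> \<beta> ^ j * (1 - \<beta>)"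
  shows "trunc_exit L u k \<subseteq> zero_run J k"
proof
  fix \<omega> assume \<omega>: "\<omega> \<in> trunc_exit L u k"
  have "\<delta> (int k - int j) \<omega> = 0" if "j < J" for j
  proof (rule ccontr)
    assume "\<delta> (int k - int j) \<omega> \<noteq> 0"
    then have "u \<le> \<beta> ^ j * \<delta> (int k - int j) \<omega>" using assms(2)[OF that] innovation_neq_0 by simp
    also have "\<dots> \<le> Z L k \<omega>"
      unfolding Z_def using that assms(1) \<beta> innovation_nonneg
      by (intro member_le_sum[where f="\<lambda>j. \<beta> ^ j * \<delta> (int k - int j) \<omega>"]) auto
    finally show False using \<omega> by (simp add: trunc_exit_def)
  qed
  then show "\<omega> \<in> zero_run J k" using \<omega> by (auto simp: trunc_exit_def zero_run_def)
qed

text \<open>The exit at \<open>n\<close> forces \<open>J\<close> zeros up to time \<open>n\<close>.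
  If these cover \<open>k + 1\<close> they exclude the exit at \<open>k\<close>, which needs a
  nonzero innovation there; otherwise they are independent of it and have probability
  \<open>q ^ J\<close>.\<close>

lemma prob_trunc_exit_Int_le:
  assumes "J \<le> L" and "\<And>j. j < J \<Longrightarrow> u \<le> \<beta> ^ j * (1 - \<beta>)" and "k < n"
  shows "prob (trunc_exit L u k \<inter> trunc_exit L u n) \<le> prob (trunc_exit L u k) * q ^ J"
proof (cases "n - k \<le> J")
  case True
  have "trunc_exit L u k \<inter> zero_run J n = {}"
  proof -
    have "\<delta> (int k + 1) \<omega> = 0" if "\<omega> \<in> zero_run J n" for \<omega>
    proof -
      have "int n - int (n - k - 1) = int k + 1" "n - k - 1 < J" using True assms(3) by auto
      then show ?thesis using that unfolding zero_run_def by (metis (mono_tags, lifting) mem_Collect_eq)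
    qed
    then show ?thesis by (auto simp: trunc_exit_def)
  qed
  then have "trunc_exit L u k \<inter> trunc_exit L u n = {}"
    using trunc_exit_subset_zero_run[OF assms(1,2), of n] by auto
  then show ?thesis using q by simp
next
  case False
  have "prob (trunc_exit L u k \<inter> trunc_exit L u n) \<le> prob (trunc_exit L u k \<inter> zero_run J n)"
    using trunc_exit_subset_zero_run[OF assms(1,2), of n] by (intro finite_measure_mono) auto
  also have "\<dots> = prob (trunc_exit L u k) * q ^ J"
    unfolding prob_zero_run[of J n, symmetric]
    using False assms(3)
    by (intro prob_Int_sigma_fam[OF sets_trunc_exit[OF subset_refl] sets_zero_run[OF subset_refl]]) auto
  finally show ?thesis .
qed

text \<open>Exits more than \<open>L\<close> steps in the past are independent of an exit at time \<open>n\<close>, and two exits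
  within \<open>L\<close> steps are unlikely, because the second one must be preceded by \<open>J\<close> zeros.\<close>

lemma prob_avoid_Suc:
  assumes "J \<le> L" and "\<And>j. j < J \<Longrightarrow> u \<le> \<beta> ^ j * (1 - \<beta>)"
  defines "\<pi> \<equiv> (1 - q) * F u" and "\<kappa> \<equiv> F (u + \<beta> ^ L) - F u"
  shows "\<bar>prob (avoid L u (Suc n)) - (1 - \<pi>) * prob (avoid L u n)\<bar> \<le> (\<pi> + \<kappa>) * (real L * q ^ J) + \<kappa>"
proof -
  let ?A = "avoid L u" and ?G = "trunc_exit L u"
  define W where "W = {n - L..<n}"
  have W: "finite W" "card W \<le> L" by (auto simp: W_def)
  have pi: "\<pi> \<le> prob (?G k)" "prob (?G k) \<le> \<pi> + \<kappa>" for k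
    using prob_trunc_exit_ge prob_trunc_exit_le by (simp_all add: \<pi>_def \<kappa>_def)
  have pi0: "0 \<le> \<pi> + \<kappa>" using order_trans[OF measure_nonneg pi(2)] .
  have piq: "prob (?G k) \<le> q ^ J" for k
    using finite_measure_mono[OF trunc_exit_subset_zero_run[OF assms(1,2)], of k] by (simp add: prob_zero_run)
  have sumW: "(\<Sum>k\<in>W. f k) \<le> real L * b" if "\<And>k. k \<in> W \<Longrightarrow> f k \<le> b" "0 \<le> b" for f and b :: real
  proof -
    have "(\<Sum>k\<in>W. f k) \<le> real (card W) * b" using that(1) by (rule sum_bounded_above)
    also have "\<dots> \<le> real L * b" using W(2) that(2) by (intro mult_right_mono) auto
    finally show ?thesis .
  qed
  \<comment> \<open>The first event depends on indices up to \<open>n - L\<close>, the exit at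
    \<open>n\<close> on later ones. For \<open>n < L\<close> truncated subtraction gives 0, and the
    first event is the whole space.\<close>
  have indep: "prob (?A (n - L) \<inter> ?G n) = prob (?A (n - L)) * prob (?G n)"
  proof (cases "L \<le> n")
    case True
    then show ?thesis
      by (intro prob_Int_sigma_fam[OF sets_avoid[OF subset_refl] sets_trunc_exit[OF subset_refl]]) auto
  next
    case False
    have "?A 0 \<inter> ?G n = ?G n" by (auto simp: avoid_def trunc_exit_def)
    moreover have "?A 0 = space M" by (auto simp: avoid_def)
    ultimately show ?thesis using False by (simp add: prob_space)
  qed
  have past: "?A (n - L) \<subseteq> ?A n \<union> (\<Union>k\<in>W. ?G k)"
  proof
    fix \<omega> assume \<omega>: "\<omega> \<in> ?A (n - L)"
    have "k < n - L \<or> k \<in> W" if "k < n" for k using that by (auto simp: W_def)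
    then show "\<omega> \<in> ?A n \<union> (\<Union>k\<in>W. ?G k)" using \<omega> unfolding avoid_def by blast
  qed
  \<comment> \<open>The drop in probability from \<open>n\<close> to \<open>Suc n\<close>. It is
    compared with \<open>prob (?G n) * prob (?A n)\<close> in both directions through
    \<open>?A (n - L)\<close>, which is independent of \<open>?G n\<close>.\<close>
  define e where "e = prob (?A n \<inter> ?G n)"
  have "?A (Suc n) = ?A n - ?G n" by (auto simp: avoid_def less_Suc_eq)
  then have Suc: "prob (?A (Suc n)) = prob (?A n) - e"
    by (simp add: e_def finite_measure_Diff')
  have "e \<le> prob (?A (n - L)) * prob (?G n)"
    unfolding e_def indep[symmetric] using avoid_antimono[of "n - L" n L u]
    by (intro finite_measure_mono) auto
  also have "prob (?A (n - L)) \<le> prob (?A n) + real L * q ^ J"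
  proof -
    have "prob (?A (n - L)) \<le> prob (?A n \<union> (\<Union>k\<in>W. ?G k))"
      using W past by (intro finite_measure_mono) auto
    also have "\<dots> \<le> prob (?A n) + prob (\<Union>k\<in>W. ?G k)"
      using W by (intro measure_Un_le) auto
    also have "prob (\<Union>k\<in>W. ?G k) \<le> (\<Sum>k\<in>W. prob (?G k))"
      using W by (intro measure_UNION_le) auto
    also have "\<dots> \<le> real L * q ^ J" using piq q by (intro sumW) auto
    finally show ?thesis by simp
  qed
  finally have "e \<le> prob (?G n) * prob (?A n) + prob (?G n) * (real L * q ^ J)"
    by (simp add: mult_right_mono algebra_simps)
  moreover have "prob (?G n) * (real L * q ^ J) \<le> (\<pi> + \<kappa>) * (real L * q ^ J)"
    using pi(2) q by (intro mult_right_mono) auto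
  moreover have "prob (?G n) * prob (?A n) \<le> e + (\<pi> + \<kappa>) * (real L * q ^ J)"
  proof -
    have "prob (?G n) * prob (?A n) \<le> prob (?A (n - L) \<inter> ?G n)"
      unfolding indep using avoid_antimono[of "n - L" n L u]
      by (subst mult.commute, intro mult_right_mono finite_measure_mono) auto
    also have "?A (n - L) \<inter> ?G n \<subseteq> (?A n \<inter> ?G n) \<union> (\<Union>k\<in>W. ?G k \<inter> ?G n)"
      using past by auto
    then have "prob (?A (n - L) \<inter> ?G n) \<le> prob ((?A n \<inter> ?G n) \<union> (\<Union>k\<in>W. ?G k \<inter> ?G n))"
      using W by (intro finite_measure_mono) auto
    also have "\<dots> \<le> e + prob (\<Union>k\<in>W. ?G k \<inter> ?G n)"
      unfolding e_def using W by (intro measure_Un_le) auto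
    also have "prob (\<Union>k\<in>W. ?G k \<inter> ?G n) \<le> (\<Sum>k\<in>W. prob (?G k \<inter> ?G n))"
      using W by (intro measure_UNION_le) auto
    also have "\<dots> \<le> real L * ((\<pi> + \<kappa>) * q ^ J)"
    proof (rule sumW)
      fix k assume "k \<in> W"
      then have "prob (?G k \<inter> ?G n) \<le> prob (?G k) * q ^ J"
        by (intro prob_trunc_exit_Int_le[OF assms(1,2)]) (auto simp: W_def)
      also have "\<dots> \<le> (\<pi> + \<kappa>) * q ^ J" using pi(2) q by (intro mult_right_mono) auto
      finally show "prob (?G k \<inter> ?G n) \<le> (\<pi> + \<kappa>) * q ^ J" .
    qed (use pi0 q in auto)
    finally show ?thesis by (simp add: mult_ac)
  qed
  \<comment> \<open>Replacing the exit probability by \<open>\<pi>\<close> costs at most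
    \<open>\<kappa>\<close>.\<close>
  moreover have "prob (?G n) * prob (?A n) \<le> \<pi> * prob (?A n) + \<kappa>"
  proof -
    have "0 \<le> \<kappa>" using F_mono[of u "u + \<beta> ^ L"] \<beta> by (simp add: \<kappa>_def)
    have "prob (?G n) * prob (?A n) \<le> (\<pi> + \<kappa>) * prob (?A n)" using pi(2) by (intro mult_right_mono) auto
    also have "\<dots> \<le> \<pi> * prob (?A n) + \<kappa>"
      using mult_left_le[of "prob (?A n)" \<kappa>] \<open>0 \<le> \<kappa>\<close> by (simp add: distrib_right)
    finally show ?thesis .
  qed
  moreover have "\<pi> * prob (?A n) \<le> prob (?G n) * prob (?A n)" using pi(1) by (intro mult_right_mono) auto
  moreover have "0 \<le> \<kappa>" using F_mono[of u "u + \<beta> ^ L"] \<beta> by (simp add: \<kappa>_def)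
  ultimately show ?thesis unfolding Suc abs_le_iff by (simp add: algebra_simps)
qed

text \<open>The one-step errors add up: multiplication by \<open>1 - \<pi>\<close>, which lies in
  \<open>[0, 1]\<close>, does not enlarge the error made so far.\<close>

lemma prob_avoid_approx:
  assumes "J \<le> L" and "\<And>j. j < J \<Longrightarrow> u \<le> \<beta> ^ j * (1 - \<beta>)"
  defines "\<pi> \<equiv> (1 - q) * F u" and "\<kappa> \<equiv> F (u + \<beta> ^ L) - F u"
  shows "\<bar>prob (avoid L u n) - (1 - \<pi>) ^ n\<bar> \<le> real n * ((\<pi> + \<kappa>) * (real L * q ^ J) + \<kappa>)"
proof (induction n)
  case 0
  then show ?case by (simp add: avoid_def prob_space)
next
  case (Suc n)
  have pi: "0 \<le> \<pi>" "\<pi> \<le> 1"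
    using q F_nonneg[of u] F_le_1[of u] mult_le_one[of "1 - q" "F u"] by (simp_all add: \<pi>_def)
  have "\<bar>(1 - \<pi>) * (prob (avoid L u n) - (1 - \<pi>) ^ n)\<bar> \<le> \<bar>prob (avoid L u n) - (1 - \<pi>) ^ n\<bar>"
    using pi by (simp add: abs_mult mult_left_le_one_le)
  moreover have "prob (avoid L u (Suc n)) - (1 - \<pi>) ^ Suc n =
      (prob (avoid L u (Suc n)) - (1 - \<pi>) * prob (avoid L u n)) + (1 - \<pi>) * (prob (avoid L u n) - (1 - \<pi>) ^ n)"
    by (simp add: algebra_simps)
  moreover have "\<bar>prob (avoid L u (Suc n)) - (1 - \<pi>) * prob (avoid L u n)\<bar> \<le> (\<pi> + \<kappa>) * (real L * q ^ J) + \<kappa>"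
    unfolding \<pi>_def \<kappa>_def by (rule prob_avoid_Suc[OF assms(1,2)])
  moreover have "real (Suc n) * ((\<pi> + \<kappa>) * (real L * q ^ J) + \<kappa>)
      = real n * ((\<pi> + \<kappa>) * (real L * q ^ J) + \<kappa>) + ((\<pi> + \<kappa>) * (real L * q ^ J) + \<kappa>)"
    by (simp add: distrib_right)
  ultimately show ?case using Suc by linarith
qed

text \<open>At a zero innovation the process is multiplied by \<open>\<beta>\<close> and cannot
  rise, so a visit below \<open>u\<close> ends through an exit or lasts until
  \<open>n\<close>.\<close>

lemma process_less_or_exit:
  assumes "k \<le> n" "Y k \<omega> < u"
  shows "(\<exists>i\<in>{k..<n}. Y i \<omega> < u \<and> \<delta> (int i + 1) \<omega> \<noteq> 0) \<or> Y n \<omega> < u"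
  using assms
proof (induction n rule: dec_induct)
  case (step n)
  consider "\<exists>i\<in>{k..<n}. Y i \<omega> < u \<and> \<delta> (int i + 1) \<omega> \<noteq> 0" | "Y n \<omega> < u" "\<delta> (int n + 1) \<omega> \<noteq> 0"
    | "Y n \<omega> < u" "\<delta> (int n + 1) \<omega> = 0" using step by blast
  then show ?case
  proof cases
    case 1
    then show ?thesis using less_SucI by fastforce
  next
    case 2
    then show ?thesis using step(1) by (intro disjI1 bexI[of _ n]) auto
  next
    case 3
    have "\<beta> * Y n \<omega> \<le> Y n \<omega>" using \<beta> process_nonneg by (intro mult_left_le_one_le) auto
    then show ?thesis using 3 process_Suc[of n \<omega>] by simp
  qed
qed simp

text \<open>Avoiding exits and yet falling below \<open>u\<close> means that a visit is still
  running at time \<open>n\<close>, of probability \<open>F u\<close>. Conversely, a truncated exit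
  at \<open>k\<close> while \<open>u \<le> Y k\<close> requires
  \<open>Y k < u + \<beta> ^ L\<close>, of probability \<open>\<kappa>\<close> for each
  \<open>k\<close>.\<close>

lemma prob_min_ge_approx:
  assumes "J \<le> L" and "\<And>j. j < J \<Longrightarrow> u \<le> \<beta> ^ j * (1 - \<beta>)"
  defines "\<pi> \<equiv> (1 - q) * F u" and "\<kappa> \<equiv> F (u + \<beta> ^ L) - F u"
  shows "\<bar>prob {\<omega> \<in> space M. \<forall>k<n. u \<le> Y k \<omega>} - (1 - \<pi>) ^ n\<bar>
    \<le> F u + real n * \<kappa> + real n * ((\<pi> + \<kappa>) * (real L * q ^ J) + \<kappa>)"
proof -
  let ?P = "{\<omega> \<in> space M. \<forall>k<n. u \<le> Y k \<omega>}" and ?A = "avoid L u n"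
  let ?B = "\<lambda>k. {\<omega> \<in> space M. u \<le> Y k \<omega> \<and> Y k \<omega> < u + \<beta> ^ L}"
  have "?A \<subseteq> ?P \<union> {\<omega> \<in> space M. Y n \<omega> < u}"
  proof
    fix \<omega> assume \<omega>: "\<omega> \<in> ?A"
    show "\<omega> \<in> ?P \<union> {\<omega> \<in> space M. Y n \<omega> < u}"
    proof (cases "\<exists>k<n. Y k \<omega> < u")
      case True
      then obtain k where k: "k < n" "Y k \<omega> < u" by blast
      have "\<not> (Y i \<omega> < u \<and> \<delta> (int i + 1) \<omega> \<noteq> 0)" if "i < n" for i
        using \<omega> that process_ge_Z[of L i \<omega>] by (auto simp: avoid_def trunc_exit_def)
      then have "Y n \<omega> < u" using process_less_or_exit[of k n \<omega> u] k by auto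
      then show ?thesis using \<omega> by (auto simp: avoid_def)
    next
      case False
      then have "\<forall>k<n. u \<le> Y k \<omega>" by (meson not_less)
      then show ?thesis using \<omega> by (simp add: avoid_def)
    qed
  qed
  then have "prob ?A \<le> prob (?P \<union> {\<omega> \<in> space M. Y n \<omega> < u})"
    by (rule finite_measure_mono) measurable
  also have "\<dots> \<le> prob ?P + prob {\<omega> \<in> space M. Y n \<omega> < u}"
    by (rule measure_Un_le) measurable
  finally have 1: "prob ?A \<le> prob ?P + F u" by (simp add: prob_process_less)
  have "?P \<subseteq> ?A \<union> (\<Union>k<n. ?B k)"
  proof
    fix \<omega> assume \<omega>: "\<omega> \<in> ?P"
    have "\<omega> \<in> ?B k" if "k < n" "\<omega> \<in> trunc_exit L u k" for k
      using \<omega> that process_le_Z[of k \<omega> L] by (auto simp: trunc_exit_def)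
    then show "\<omega> \<in> ?A \<union> (\<Union>k<n. ?B k)" using \<omega> unfolding avoid_def by blast
  qed
  then have "prob ?P \<le> prob (?A \<union> (\<Union>k<n. ?B k))"
    by (rule finite_measure_mono) measurable
  also have "\<dots> \<le> prob ?A + prob (\<Union>k<n. ?B k)"
    by (rule measure_Un_le) measurable
  also have "prob (\<Union>k<n. ?B k) \<le> (\<Sum>k<n. prob (?B k))"
    by (rule measure_UNION_le) auto
  also have "\<dots> = real n * \<kappa>"
    using \<beta> by (simp add: prob_process_between \<kappa>_def)
  finally have 2: "prob ?P \<le> prob ?A + real n * \<kappa>" by simp
  have 3: "\<bar>prob ?A - (1 - \<pi>) ^ n\<bar> \<le> real n * ((\<pi> + \<kappa>) * (real L * q ^ J) + \<kappa>)"
    unfolding \<pi>_def \<kappa>_def by (rule prob_avoid_approx[OF assms(1,2)])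
  have "0 \<le> \<kappa>" using F_mono[of u "u + \<beta> ^ L"] \<beta> by (simp add: \<kappa>_def)
  then have "0 \<le> real n * \<kappa>" by simp
  then show ?thesis using 1 2 3 F_nonneg[of u] unfolding abs_le_iff by linarith
qed

section \<open>The periodic function and the limit\<close>

text \<open>\<open>F (\<beta> ^ n * y) / q ^ n\<close> does not depend on \<open>n\<close> once \<open>\<beta> ^ n * y \<le> 1 / \<beta> - 1\<close>.\<close>

definition F_ext :: "real \<Rightarrow> real" where
  "F_ext y = lim (\<lambda>n. F (\<beta> ^ n * y) / q ^ n)"

lemma F_ext_eq:
  assumes "0 \<le> y" "\<beta> ^ n * y \<le> 1 / \<beta> - 1"
  shows "F_ext y = F (\<beta> ^ n * y) / q ^ n"
proof -
  have *: "F (\<beta> ^ k * y) / q ^ k = F (\<beta> ^ n * y) / q ^ n" if "n \<le> k" for k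
  proof -
    have "F (\<beta> ^ (k - n) * (\<beta> ^ n * y)) = q ^ (k - n) * F (\<beta> ^ n * y)"
      using assms \<beta> by (intro F_scale_power) auto
    moreover have "\<beta> ^ k = \<beta> ^ (k - n) * \<beta> ^ n" "q ^ k = q ^ (k - n) * q ^ n"
      using that by (simp_all flip: power_add)
    ultimately show ?thesis using q by (simp add: field_simps)
  qed
  have "(\<lambda>k. F (\<beta> ^ k * y) / q ^ k) \<longlonglongrightarrow> F (\<beta> ^ n * y) / q ^ n"
    by (rule tendsto_eventually, rule eventually_sequentiallyI[of n], rule *)
  then show ?thesis unfolding F_ext_def by (rule limI)
qed

lemma power_mult_le_cutoff:
  fixes y :: real
  assumes "0 < b" shows "\<exists>n. \<beta> ^ n * y < b"
proof -
  have "(\<lambda>n. \<beta> ^ n * y) \<longlonglongrightarrow> 0 * y" using \<beta> by (intro tendsto_intros LIMSEQ_realpow_zero) auto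
  then have "\<forall>\<^sub>F n in sequentially. \<beta> ^ n * y < b" using assms by (intro order_tendstoD) auto
  then show ?thesis using eventually_happens'[OF sequentially_bot] by blast
qed

lemma cutoff_pos: "0 < 1 / \<beta> - 1"
  using \<beta> by simp

text \<open>This is \<open>\<beta> powr (ln q / ln \<beta>) = q\<close>, in the form used for one
  period.\<close>

lemma exp_exponent: "exp (ln q / ln \<beta> * ln \<beta>) = q"
  using \<beta> q by simp

text \<open>In the variable \<open>y = exp t\<close> the function is
  \<open>F_ext y / y powr (ln q / ln \<beta>)\<close>. Multiplying \<open>y\<close> by
  \<open>\<beta>\<close> multiplies numerator and denominator by \<open>q\<close>, whence
  periodicity.\<close>

lemma is_nu_exists: "is_nu \<beta> q (\<lambda>t. F_ext (exp t) * exp (- (ln q / ln \<beta>) * t))" (is "is_nu \<beta> q ?\<nu>")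
  unfolding is_nu_def
proof (intro conjI allI impI)
  fix t
  obtain n where n: "\<beta> ^ n * exp t < 1 / \<beta> - 1" using power_mult_le_cutoff[OF cutoff_pos] by blast
  have "F_ext (exp t) = F (\<beta> ^ n * exp t) / q ^ n" using n by (intro F_ext_eq) auto
  then show "0 < ?\<nu> t" using F_pos[of "\<beta> ^ n * exp t"] \<beta> q by simp
next
  fix t
  \<comment> \<open>The larger argument \<open>exp t / \<beta>\<close> fixes \<open>n\<close>. Using
    \<open>n\<close> for \<open>exp t\<close> and \<open>Suc n\<close> for
    \<open>exp t / \<beta>\<close> leads to the same value of \<open>F\<close>.\<close>
  obtain n where n: "\<beta> ^ n * (exp t / \<beta>) < 1 / \<beta> - 1" using power_mult_le_cutoff[OF cutoff_pos] by blast
  have exp: "exp (t + ln (1 / \<beta>)) = exp t / \<beta>" using \<beta> by (simp add: exp_add ln_div exp_minus divide_inverse)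
  have "\<beta> ^ n * exp t \<le> \<beta> ^ n * (exp t / \<beta>)" using \<beta> by (intro mult_left_mono) (simp_all add: field_simps)
  then have 1: "F_ext (exp t) = F (\<beta> ^ n * exp t) / q ^ n" using n by (intro F_ext_eq) auto
  have 2: "F_ext (exp t / \<beta>) = F (\<beta> ^ Suc n * (exp t / \<beta>)) / q ^ Suc n"
  proof (rule F_ext_eq)
    show "\<beta> ^ Suc n * (exp t / \<beta>) \<le> 1 / \<beta> - 1"
      using \<open>\<beta> ^ n * exp t \<le> \<beta> ^ n * (exp t / \<beta>)\<close> n \<beta> by simp
  qed (use \<beta> in simp)
  have "exp (- a * (t + ln (1 / \<beta>))) = exp (- a * t) * exp (a * ln \<beta>)" for a
    using \<beta> by (simp add: ln_div algebra_simps flip: exp_add)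
  from this[of "ln q / ln \<beta>"]
  have e: "exp (- (ln q / ln \<beta>) * (t + ln (1 / \<beta>))) = exp (- (ln q / ln \<beta>) * t) * q"
    unfolding exp_exponent .
  show "?\<nu> (t + ln (1 / \<beta>)) = ?\<nu> t"
    using \<beta> q unfolding exp 1 2 e by simp
next
  have "isCont ?\<nu> t" for t
  proof -
    \<comment> \<open>An \<open>n\<close> that works at \<open>t + 1\<close> works for all
      \<open>s < t + 1\<close>, so one formula holds in a neighbourhood of \<open>t\<close>.\<close>
    obtain n where n: "\<beta> ^ n * exp (t + 1) < 1 / \<beta> - 1" using power_mult_le_cutoff[OF cutoff_pos] by blast
    have "F_ext (exp s) = F (\<beta> ^ n * exp s) / q ^ n" if "s < t + 1" for s
    proof (rule F_ext_eq)
      have "\<beta> ^ n * exp s \<le> \<beta> ^ n * exp (t + 1)" using \<beta> that by (intro mult_left_mono) auto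
      then show "\<beta> ^ n * exp s \<le> 1 / \<beta> - 1" using n by simp
    qed simp
    moreover have "\<forall>\<^sub>F s in nhds t. s < t + 1"
      using eventually_nhds_in_open[of "{..<t + 1}" t] by simp
    ultimately have "\<forall>\<^sub>F s in nhds t. ?\<nu> s = F (\<beta> ^ n * exp s) / q ^ n * exp (- (ln q / ln \<beta>) * s)"
      by (auto elim: eventually_mono)
    moreover have "isCont (\<lambda>s. F (\<beta> ^ n * exp s) / q ^ n * exp (- (ln q / ln \<beta>) * s)) t"
      using q by (intro continuous_intros isCont_o2[OF _ isCont_F]) auto
    ultimately show ?thesis using isCont_cong by fast
  qed
  then show "continuous_on UNIV ?\<nu>" by (simp add: continuous_at_imp_continuous_on)
next
  fix y assume y: "y \<in> (if \<beta> \<le> 1 / 2 then {0<..<1} else {0<..1 / \<beta> - 1})"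
  \<comment> \<open>Both ranges in \<open>is_nu\<close> stay within the cutoff.\<close>
  have "\<beta> \<le> 1 / 2 \<Longrightarrow> 1 \<le> 1 / \<beta> - 1" using \<beta> by (simp add: field_simps)
  then have "0 < y" "y \<le> 1 / \<beta> - 1" using y by (auto split: if_splits)
  then have "F_ext y = F y" using F_ext_eq[of y 0] by simp
  then show "F y = y powr (ln q / ln \<beta>) * ?\<nu> (ln y)"
    using \<open>0 < y\<close> by (simp add: powr_def exp_minus)
qed

lemma is_nu_shift: "is_nu \<beta> q \<nu> \<Longrightarrow> \<nu> (t + real n * ln \<beta>) = \<nu> t"
proof (induction n)
  case (Suc n)
  have "\<nu> (t + real (Suc n) * ln \<beta>) = \<nu> (t + real (Suc n) * ln \<beta> + ln (1 / \<beta>))"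
    using Suc.prems by (simp add: is_nu_def)
  also have "t + real (Suc n) * ln \<beta> + ln (1 / \<beta>) = t + real n * ln \<beta>"
    using \<beta> by (simp add: ln_div algebra_simps)
  finally show ?case using Suc by simp
qed simp

text \<open>Below \<open>min 1 (1 / \<beta> - 1)\<close> both cases of \<open>is_nu\<close> apply,
  which spares later case distinctions.\<close>

lemma is_nu_eq:
  assumes "is_nu \<beta> q \<nu>" "0 < y" "y < min 1 (1 / \<beta> - 1)"
  shows "F y = y powr (ln q / ln \<beta>) * \<nu> (ln y)"
  using assms unfolding is_nu_def by (auto split: if_splits)

text \<open>Two candidates agree below the logarithm of the cutoff, hence everywhere by periodicity.\<close>

lemma is_nu_nu: "is_nu \<beta> q (nu \<beta> q)"
  unfolding nu_def
proof (rule theI[where P = "is_nu \<beta> q", OF is_nu_exists])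
  fix \<nu> assume \<nu>: "is_nu \<beta> q \<nu>"
  have agree: "\<nu>1 t = \<nu>2 t" if 1: "is_nu \<beta> q \<nu>1" and 2: "is_nu \<beta> q \<nu>2" for \<nu>1 \<nu>2 t
  proof -
    obtain n where n: "\<beta> ^ n * exp t < min 1 (1 / \<beta> - 1)"
      using power_mult_le_cutoff[of "min 1 (1 / \<beta> - 1)" "exp t"] cutoff_pos by auto
    have pos: "0 < \<beta> ^ n * exp t" using \<beta> by simp
    have "\<nu>1 (ln (\<beta> ^ n * exp t)) = \<nu>2 (ln (\<beta> ^ n * exp t))"
      using is_nu_eq[OF 1 pos n] is_nu_eq[OF 2 pos n] pos \<beta> by simp
    moreover have "ln (\<beta> ^ n * exp t) = t + real n * ln \<beta>"
      using \<beta> by (simp add: ln_mult ln_realpow)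
    ultimately show ?thesis using is_nu_shift[OF 1] is_nu_shift[OF 2] by simp
  qed
  show "\<nu> = (\<lambda>t. F_ext (exp t) * exp (- (ln q / ln \<beta>) * t))"
    by (rule ext) (rule agree[OF \<nu> is_nu_exists])
qed

text \<open>For \<open>y > 0\<close> this is \<open>- ln (H \<beta> q (- y))\<close>.\<close>

definition \<tau> :: "real \<Rightarrow> real" where
  "\<tau> y = y powr (ln q / ln \<beta>) * nu \<beta> q (ln y)"

lemma isCont_\<tau>: "0 < y \<Longrightarrow> isCont \<tau> y"
proof -
  assume "0 < y"
  have "isCont (nu \<beta> q) t" for t
    using is_nu_nu continuous_on_eq_continuous_at[of UNIV] by (auto simp: is_nu_def)
  then show ?thesis unfolding \<tau>_def[abs_def] using \<open>0 < y\<close>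
    by (intro continuous_intros isCont_o2[OF isCont_ln]) auto
qed

text \<open>Scaling by \<open>\<beta> ^ m\<close> moves \<open>ln y\<close> by \<open>m\<close> full
  periods, to which \<open>nu\<close> is blind, and pulls the factor \<open>q ^ m\<close> out of the
  power.\<close>

lemma F_eq_\<tau>:
  assumes "0 < y" "\<beta> ^ m * y < min 1 (1 / \<beta> - 1)"
  shows "F (\<beta> ^ m * y) = q ^ m * \<tau> y"
proof -
  have "0 < \<beta> ^ m * y" using assms \<beta> by simp
  then have "F (\<beta> ^ m * y) = (\<beta> ^ m * y) powr (ln q / ln \<beta>) * nu \<beta> q (ln (\<beta> ^ m * y))"
    by (rule is_nu_eq[OF is_nu_nu _ assms(2)])
  also have "ln (\<beta> ^ m * y) = ln y + real m * ln \<beta>"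
    using \<beta> assms by (simp add: ln_mult ln_realpow)
  also have "nu \<beta> q \<dots> = nu \<beta> q (ln y)" by (rule is_nu_shift[OF is_nu_nu])
  also have "(\<beta> ^ m * y) powr (ln q / ln \<beta>) = (\<beta> ^ m) powr (ln q / ln \<beta>) * y powr (ln q / ln \<beta>)"
    using \<beta> assms by (intro powr_mult)
  also have "(\<beta> ^ m) powr (ln q / ln \<beta>) = q ^ m"
  proof -
    have "(\<beta> ^ m) powr (ln q / ln \<beta>) = exp (real m * ln q)"
      using \<beta> by (simp add: powr_def ln_realpow)
    also have "\<dots> = q ^ m" using q by (simp add: exp_of_nat_mult)
    finally show ?thesis .
  qed
  finally show ?thesis by (simp add: \<tau>_def)
qed

text \<open>Eventually \<open>F\<close> equals \<open>q ^ m i * \<tau> (w i)\<close>, and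
  \<open>\<tau>\<close> is continuous. The weights \<open>c\<close> cover both a bare probability
  (\<open>c = 1\<close>, \<open>r = 0\<close>) and its multiple by the sample size; varying
  \<open>w\<close> admits perturbed levels.\<close>

lemma tendsto_F_scaled:
  fixes c :: "nat \<Rightarrow> real"
  assumes m: "filterlim m at_top sequentially" and w: "w \<longlonglongrightarrow> y" and "0 < y"
    and c: "(\<lambda>i. c i * q ^ m i) \<longlonglongrightarrow> r"
  shows "(\<lambda>i. c i * F (\<beta> ^ m i * w i)) \<longlonglongrightarrow> r * \<tau> y"
proof -
  have "(\<lambda>i. \<beta> ^ m i) \<longlonglongrightarrow> 0"
    using filterlim_compose[OF LIMSEQ_realpow_zero[of \<beta>] m] \<beta> by simp
  from tendsto_mult[OF this w] have "\<forall>\<^sub>F i in sequentially. \<beta> ^ m i * w i < min 1 (1 / \<beta> - 1)"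
    using cutoff_pos by (intro order_tendstoD) auto
  moreover have "\<forall>\<^sub>F i in sequentially. 0 < w i" using w \<open>0 < y\<close> by (rule order_tendstoD)
  ultimately have "\<forall>\<^sub>F i in sequentially. c i * q ^ m i * \<tau> (w i) = c i * F (\<beta> ^ m i * w i)"
    by eventually_elim (simp add: F_eq_\<tau>)
  moreover have "(\<lambda>i. c i * q ^ m i * \<tau> (w i)) \<longlonglongrightarrow> r * \<tau> y"
    by (intro tendsto_mult c isCont_tendsto_compose[OF isCont_\<tau> w] \<open>0 < y\<close>)
  ultimately show ?thesis by (rule Lim_transform_eventually[rotated])
qed

text \<open>Apply \<open>prob_min_ge_approx\<close> with \<open>L = 2 * m i\<close> and
  \<open>J = m i - s\<close>: then \<open>\<beta> ^ L\<close> is negligible against the level, and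
  \<open>L * q ^ J\<close> tends to 0, while \<open>n i * F (u i)\<close> converges.\<close>

lemma tendsto_prob_min_ge:
  fixes n m :: "nat \<Rightarrow> nat"
  assumes m: "filterlim m at_top sequentially" and y: "ys \<longlonglongrightarrow> y" "0 < y"
    and n: "(\<lambda>i. real (n i) * q ^ m i) \<longlonglongrightarrow> r"
  shows "(\<lambda>i. prob {\<omega> \<in> space M. \<forall>k<n i. \<beta> ^ m i * ys i \<le> Y k \<omega>}) \<longlonglongrightarrow> exp (- ((1 - q) * (r * \<tau> y)))"
proof -
  let ?P = "\<lambda>i. prob {\<omega> \<in> space M. \<forall>k<n i. \<beta> ^ m i * ys i \<le> Y k \<omega>}"
  define u where "u i = \<beta> ^ m i * ys i" for i
  define \<pi> where "\<pi> i = (1 - q) * F (u i)" for i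
  define \<kappa> where "\<kappa> i = F (u i + \<beta> ^ (2 * m i)) - F (u i)" for i
  \<comment> \<open>The shift \<open>s\<close> absorbs constants: eventually
    \<open>u i \<le> \<beta> ^ m i * (y + 1)\<close>, which is at most
    \<open>\<beta> ^ j * (1 - \<beta>)\<close> once \<open>j + s \<le> m i\<close>.\<close>
  have "(\<lambda>s. (y + 1) * \<beta> ^ s) \<longlonglongrightarrow> (y + 1) * 0"
    using \<beta> by (intro tendsto_intros LIMSEQ_realpow_zero) auto
  then have "\<forall>\<^sub>F s in sequentially. (y + 1) * \<beta> ^ s < 1 - \<beta>" using \<beta> by (intro order_tendstoD) auto
  then obtain s where s: "(y + 1) * \<beta> ^ s < 1 - \<beta>"
    using eventually_happens'[OF sequentially_bot] by blast
  define b where "b i = real (2 * m i) * q ^ (m i - s)" for i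
  have \<beta>m: "(\<lambda>i. \<beta> ^ m i) \<longlonglongrightarrow> 0" and qm: "(\<lambda>i. q ^ m i) \<longlonglongrightarrow> 0"
    using filterlim_compose[OF LIMSEQ_realpow_zero m] \<beta> q by simp_all
  have F0: "(\<lambda>i. F (u i)) \<longlonglongrightarrow> 0"
    using tendsto_F_scaled[OF m y, of "\<lambda>_. 1" 0] qm by (simp add: u_def)
  have nF: "(\<lambda>i. real (n i) * F (u i)) \<longlonglongrightarrow> r * \<tau> y"
    unfolding u_def by (rule tendsto_F_scaled[OF m y n])
  have n\<pi>: "(\<lambda>i. real (n i) * \<pi> i) \<longlonglongrightarrow> (1 - q) * (r * \<tau> y)"
    using tendsto_mult_left[OF nF, of "1 - q"] by (simp add: \<pi>_def mult_ac)
  \<comment> \<open>Raising the level by \<open>\<beta> ^ (2 * m i)\<close> replaces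
    \<open>ys i\<close> by \<open>ys i + \<beta> ^ m i\<close>, which has the same limit.\<close>
  have n\<kappa>: "(\<lambda>i. real (n i) * \<kappa> i) \<longlonglongrightarrow> 0"
  proof -
    have "(\<lambda>i. ys i + \<beta> ^ m i) \<longlonglongrightarrow> y + 0" by (intro tendsto_add y \<beta>m)
    then have "(\<lambda>i. real (n i) * F (\<beta> ^ m i * (ys i + \<beta> ^ m i))) \<longlonglongrightarrow> r * \<tau> y"
      using y(2) by (intro tendsto_F_scaled[OF m _ _ n]) auto
    moreover have "\<beta> ^ m i * (ys i + \<beta> ^ m i) = u i + \<beta> ^ (2 * m i)" for i
      by (simp add: u_def distrib_left mult_2 power_add)
    ultimately show ?thesis using tendsto_diff[OF _ nF] by (fastforce simp: \<kappa>_def right_diff_distrib)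
  qed
  have b: "b \<longlonglongrightarrow> 0"
  proof -
    have "(\<lambda>i. 2 / q ^ s * (real (m i) * q ^ m i)) \<longlonglongrightarrow> 2 / q ^ s * 0"
      using filterlim_compose[OF powser_times_n_limit_0[of q] m] q by (intro tendsto_mult_left) simp
    \<comment> \<open>Eventually \<open>s \<le> m i\<close>, so the subtraction in \<open>b\<close>
      is not truncated.\<close>
    moreover have "\<forall>\<^sub>F i in sequentially. 2 / q ^ s * (real (m i) * q ^ m i) = b i"
      using filterlim_at_top[THEN iffD1, OF m, rule_format, of s]
    proof eventually_elim
      case (elim i)
      then have "q ^ m i = q ^ (m i - s) * q ^ s" by (simp flip: power_add)
      then show ?case using q by (simp add: b_def)
    qed
    ultimately show ?thesis by (simp add: Lim_transform_eventually)
  qed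
  have "(\<lambda>i. ?P i - (1 - \<pi> i) ^ n i) \<longlonglongrightarrow> 0"
  proof (rule Lim_null_comparison)
    have "(\<lambda>i. F (u i) + real (n i) * \<kappa> i + ((real (n i) * \<pi> i + real (n i) * \<kappa> i) * b i + real (n i) * \<kappa> i))
        \<longlonglongrightarrow> 0 + 0 + (((1 - q) * (r * \<tau> y) + 0) * 0 + 0)"
      by (intro tendsto_intros F0 n\<kappa> n\<pi> b)
    then show "(\<lambda>i. F (u i) + real (n i) * \<kappa> i + real (n i) * ((\<pi> i + \<kappa> i) * b i + \<kappa> i)) \<longlonglongrightarrow> 0"
      by (simp add: algebra_simps)
    have "\<forall>\<^sub>F i in sequentially. ys i < y + 1" using y by (intro order_tendstoD) auto
    then show "\<forall>\<^sub>F i in sequentially. norm (?P i - (1 - \<pi> i) ^ n i)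
        \<le> F (u i) + real (n i) * \<kappa> i + real (n i) * ((\<pi> i + \<kappa> i) * b i + \<kappa> i)"
    proof eventually_elim
      case (elim i)
      have small: "u i \<le> \<beta> ^ j * (1 - \<beta>)" if "j < m i - s" for j
      proof -
        have "u i \<le> \<beta> ^ m i * (y + 1)" unfolding u_def using elim \<beta> by (intro mult_left_mono) auto
        also have "\<dots> \<le> \<beta> ^ (j + s) * (y + 1)"
          using \<beta> that y by (intro mult_right_mono power_decreasing) auto
        also have "\<dots> \<le> \<beta> ^ j * (1 - \<beta>)"
          using s \<beta> by (simp add: power_add mult_ac)
        finally show ?thesis .
      qed
      show ?case
        using prob_min_ge_approx[of "m i - s" "2 * m i" "u i" "n i"] small
        unfolding \<pi>_def \<kappa>_def b_def u_def[symmetric] by simp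
    qed
  qed
  moreover have "(\<lambda>i. (1 - \<pi> i) ^ n i) \<longlonglongrightarrow> exp (- ((1 - q) * (r * \<tau> y)))"
  proof (rule tendsto_power_exp[OF n\<pi>])
    show "\<pi> \<longlonglongrightarrow> 0" using tendsto_mult_left[OF F0, of "1 - q"] by (simp add: \<pi>_def[abs_def])
    show "0 \<le> \<pi> i" "\<pi> i \<le> 1" for i
      using q F_nonneg[of "u i"] F_le_1[of "u i"] mult_le_one[of "1 - q" "F (u i)"] by (simp_all add: \<pi>_def)
  qed
  ultimately show ?thesis by (rule Lim_transform[rotated])
qed

end

section \<open>The normalizing sequences\<close>

lemma k_seq_bounds:
  assumes "0 < q" "q < 1"
  shows "1 \<le> k_seq q m" "real (k_seq q m) \<le> (1 / q) ^ m" "(1 / q) ^ m < real (k_seq q m) + 1"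
proof -
  have 1: "1 \<le> (1 / q) ^ m" using assms by (intro one_le_power) simp
  then have "1 \<le> \<lfloor>(1 / q) ^ m\<rfloor>" by simp
  then have "real (k_seq q m) = of_int \<lfloor>(1 / q) ^ m\<rfloor>" by (simp add: k_seq_def)
  with 1 show "real (k_seq q m) \<le> (1 / q) ^ m" "(1 / q) ^ m < real (k_seq q m) + 1" by linarith+
  show "1 \<le> k_seq q m" using \<open>1 \<le> \<lfloor>(1 / q) ^ m\<rfloor>\<close> by (simp add: k_seq_def le_nat_iff)
qed

lemma k_seq_mono:
  assumes "0 < q" "q < 1" "m \<le> n"
  shows "k_seq q m \<le> k_seq q n"
  unfolding k_seq_def using assms
  by (intro nat_mono floor_mono power_increasing) simp_all

text \<open>One less than the least index at which \<open>k_seq q\<close> exceeds \<open>n\<close>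
  is the index sought; monotonicity makes it unique even where \<open>k_seq q\<close> repeats
  values. The bound forces \<open>m_seq q n\<close> to infinity.\<close>

lemma m_seq_less:
  assumes q: "0 < q" "q < 1" and n: "k_seq q 1 \<le> n"
  shows "real n < (1 / q) ^ (m_seq q n + 1)"
proof -
  obtain k where k: "real n + 1 < (1 / q) ^ k"
    using real_arch_pow[of "1 / q"] q by auto
  define m where "m = (LEAST k. n < k_seq q k)"
  have "n < k_seq q k" using k_seq_bounds(3)[OF q, of k] k by simp
  then have m: "n < k_seq q m" "\<And>j. j < m \<Longrightarrow> k_seq q j \<le> n"
    unfolding m_def by (rule LeastI, meson not_less_Least not_less)
  have "m \<noteq> 0" "m \<noteq> 1"
    using m(1) n k_seq_mono[OF q, of 0 1] by (intro notI, simp)+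
  then have "1 \<le> m - 1" "m - 1 + 1 = m" by auto
  have "m_seq q n = m - 1"
    unfolding m_seq_def
  proof (rule the_equality)
    show "1 \<le> m - 1 \<and> k_seq q (m - 1) \<le> n \<and> n < k_seq q (m - 1 + 1)"
      using m \<open>1 \<le> m - 1\<close> \<open>m - 1 + 1 = m\<close> by simp
    fix j assume j: "1 \<le> j \<and> k_seq q j \<le> n \<and> n < k_seq q (j + 1)"
    have "m \<le> j + 1" using j m(2)[of "j + 1"] by (meson not_le)
    moreover have "j < m" using j m(1) k_seq_mono[OF q, of m j] by (meson le_less_trans not_le)
    ultimately show "j = m - 1" by simp
  qed
  then have "real n < real (k_seq q (m_seq q n + 1))"
    using m(1) \<open>m - 1 + 1 = m\<close> by simp
  also have "\<dots> \<le> (1 / q) ^ (m_seq q n + 1)" by (rule k_seq_bounds(2)[OF q])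
  finally show ?thesis .
qed

lemma filterlim_m_seq:
  assumes "0 < q" "q < 1"
  shows "filterlim (m_seq q) at_top sequentially"
  unfolding filterlim_at_top
proof
  fix C
  obtain N where N: "(1 / q) ^ C < real N" using reals_Archimedean2 by blast
  show "\<forall>\<^sub>F n in sequentially. C \<le> m_seq q n"
  proof (rule eventually_sequentiallyI[of "max N (k_seq q 1)"])
    fix n assume n: "max N (k_seq q 1) \<le> n"
    then have "(1 / q) ^ C < (1 / q) ^ (m_seq q n + 1)"
      using N m_seq_less[OF assms, of n] by linarith
    then have "C < m_seq q n + 1" using assms by (intro power_less_imp_less_exp[of "1 / q"]) auto
    then show "C \<le> m_seq q n" by simp
  qed
qed

text \<open>The floor changes \<open>(1 / q) ^ m\<close> by less than 1, and thus the product by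
  less than \<open>q ^ m\<close>.\<close>

lemma k_seq_asymp:
  assumes "0 < q" "q < 1"
  shows "(\<lambda>m. real (k_seq q m) * q ^ m) \<longlonglongrightarrow> 1"
proof (rule real_tendsto_sandwich)
  have "(\<lambda>m. 1 - q ^ m) \<longlonglongrightarrow> 1 - 0"
    using assms by (intro tendsto_intros LIMSEQ_realpow_zero) auto
  then show "(\<lambda>m. 1 - q ^ m) \<longlonglongrightarrow> 1" by simp
  have qm: "0 < q ^ m" "(1 / q) ^ m * q ^ m = 1" for m using assms by (simp_all flip: power_mult_distrib)
  have "1 - q ^ m \<le> real (k_seq q m) * q ^ m" for m
    using mult_right_mono[OF less_imp_le[OF k_seq_bounds(3)[OF assms, of m]], of "q ^ m"] qm[of m]
    by (simp add: distrib_right)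
  then show "\<forall>\<^sub>F m in sequentially. 1 - q ^ m \<le> real (k_seq q m) * q ^ m" by simp
  have "real (k_seq q m) * q ^ m \<le> 1" for m
    using mult_right_mono[OF k_seq_bounds(2)[OF assms, of m], of "q ^ m"] qm[of m] by simp
  then show "\<forall>\<^sub>F m in sequentially. real (k_seq q m) * q ^ m \<le> 1" by simp
qed simp

section \<open>Reflection\<close>

text \<open>Defined from \<open>\<epsilon> j \<omega> = 1 - \<beta>\<close> rather than as \<open>1 - \<beta> - \<epsilon> j \<omega>\<close>, so that it is two-valued
  everywhere and not only almost surely.\<close>

definition reflected_innovation :: "real \<Rightarrow> (int \<Rightarrow> 'a \<Rightarrow> real) \<Rightarrow> int \<Rightarrow> 'a \<Rightarrow> real" where
  "reflected_innovation \<beta> \<epsilon> j \<omega> = (if \<epsilon> j \<omega> = 1 - \<beta> then 0 else 1 - \<beta>)"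

lemma ar1_reflected:
  fixes \<beta> p :: real
  assumes "0 < \<beta>" "\<beta> < 1" "0 < p" "p < 1" and inn: "ar1_innovations M \<beta> p \<epsilon>"
  shows "ar1 M \<beta> (1 - p) (reflected_innovation \<beta> \<epsilon>)"
proof -
  interpret prob_space M using inn by (simp add: ar1_innovations_def)
  have ind: "indep_vars (\<lambda>_. borel) \<epsilon> UNIV" using inn by (simp add: ar1_innovations_def)
  then have [measurable]: "\<epsilon> j \<in> borel_measurable M" for j by (auto simp: indep_vars_def)
  have "indep_vars (\<lambda>_. borel) (\<lambda>j. (\<lambda>e. if e = 1 - \<beta> then 0 else 1 - \<beta>) \<circ> \<epsilon> j) UNIV"
    by (rule indep_vars_compose[OF ind]) auto
  then have 1: "indep_vars (\<lambda>_. borel) (reflected_innovation \<beta> \<epsilon>) UNIV"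
    by (simp add: reflected_innovation_def[abs_def] o_def)
  have eq0: "reflected_innovation \<beta> \<epsilon> j \<omega> = 0 \<longleftrightarrow> \<epsilon> j \<omega> = 1 - \<beta>"
    and eq1: "reflected_innovation \<beta> \<epsilon> j \<omega> = 1 - \<beta> \<longleftrightarrow> \<not> \<epsilon> j \<omega> = 1 - \<beta>" for j \<omega>
    using assms by (auto simp: reflected_innovation_def)
  have "prob {\<omega> \<in> space M. \<epsilon> j \<omega> = 1 - \<beta>} = 1 - p" for j
    using inn by (simp add: ar1_innovations_def)
  moreover from this have "prob {\<omega> \<in> space M. \<not> \<epsilon> j \<omega> = 1 - \<beta>} = p" for j
    using prob_neg[of "\<lambda>\<omega>. \<epsilon> j \<omega> = 1 - \<beta>"] by simp
  ultimately have "ar1_innovations M \<beta> (1 - p) (reflected_innovation \<beta> \<epsilon>)"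
    unfolding ar1_innovations_def eq0 eq1 using 1 prob_space_axioms by simp
  then show ?thesis
    using assms by unfold_locales (auto simp: reflected_innovation_def)
qed

text \<open>With all innovations equal to \<open>1 - \<beta>\<close> the series sums to 1, so the
  termwise reflection turns the process into 1 minus its mirror image. One null set serves the
  countably many innovations, hence all \<open>k\<close>.\<close>

lemma AE_reflected_process:
  fixes \<beta> p :: real
  assumes "0 < \<beta>" "\<beta> < 1" "0 < p" "p < 1" and inn: "ar1_innovations M \<beta> p \<epsilon>"
  shows "AE \<omega> in M. \<forall>k. ar1_process \<beta> \<epsilon> k \<omega> = 1 - ar1_process \<beta> (reflected_innovation \<beta> \<epsilon>) k \<omega>"
proof -
  interpret R: ar1 M \<beta> "1 - p" "reflected_innovation \<beta> \<epsilon>" by (rule ar1_reflected[OF assms])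
  have [measurable]: "\<epsilon> j \<in> borel_measurable M" for j
    using inn by (auto simp: ar1_innovations_def R.indep_vars_def)
  have prob: "R.prob {\<omega> \<in> space M. \<epsilon> j \<omega> = 0} = p" "R.prob {\<omega> \<in> space M. \<epsilon> j \<omega> = 1 - \<beta>} = 1 - p" for j
    using inn by (auto simp: ar1_innovations_def)
  have "AE \<omega> in M. \<epsilon> j \<omega> = 1 - \<beta> - reflected_innovation \<beta> \<epsilon> j \<omega>" for j
  proof -
    have "R.prob ({\<omega> \<in> space M. \<epsilon> j \<omega> = 0} \<union> {\<omega> \<in> space M. \<epsilon> j \<omega> = 1 - \<beta>}) = 1"
      using assms prob[of j] by (subst R.finite_measure_Union) auto
    then have "AE \<omega> in M. \<omega> \<in> {\<omega> \<in> space M. \<epsilon> j \<omega> = 0} \<union> {\<omega> \<in> space M. \<epsilon> j \<omega> = 1 - \<beta>}"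
      by (rule R.AE_prob_1)
    then show ?thesis by eventually_elim (auto simp: reflected_innovation_def)
  qed
  then have "AE \<omega> in M. \<forall>j. \<epsilon> j \<omega> = 1 - \<beta> - reflected_innovation \<beta> \<epsilon> j \<omega>"
    by (simp add: AE_all_countable)
  then show ?thesis
  proof eventually_elim
    case (elim \<omega>)
    let ?\<delta> = "reflected_innovation \<beta> \<epsilon>"
    have "(\<lambda>j. \<beta> ^ j * (1 - \<beta>)) sums (1 / (1 - \<beta>) * (1 - \<beta>))"
      using assms by (intro sums_mult2 geometric_sums) simp
    then have "(\<lambda>j. \<beta> ^ j * (1 - \<beta>)) sums 1" using assms by simp
    from sums_diff[OF this summable_sums[OF R.summable_process]]
    have "(\<lambda>j. \<beta> ^ j * \<epsilon> (int k - int j) \<omega>) sums (1 - ar1_process \<beta> ?\<delta> k \<omega>)" for k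
      unfolding ar1_process_def using elim by (simp add: right_diff_distrib)
    then show ?case by (auto simp: ar1_process_def sums_iff)
  qed
qed

section \<open>The limit for the maximum\<close>

theorem theorem4p3:
  fixes M :: "'a measure" and \<epsilon> :: "int \<Rightarrow> 'a \<Rightarrow> real"
    and \<beta> p q c r x :: real and s :: "nat \<Rightarrow> nat" and xs :: "nat \<Rightarrow> real"
  assumes "0 < \<beta>" "\<beta> < 1" "0 < p" "p < 1" "q = 1 - p" "c = 1 / q"
    and "ar1_innovations M \<beta> p \<epsilon>"
    and "strict_mono s" "\<And>i. 1 \<le> s i"
    and "r \<in> {1..c}" "(\<lambda>i. r_seq q (s i)) \<longlonglongrightarrow> r"
    and "\<And>i. xs i \<le> 0" "xs \<longlonglongrightarrow> x" "x < 0"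
  shows "(\<lambda>i. measure M {\<omega> \<in> space M. a_seq \<beta> q (s i) * (ar1_max \<beta> \<epsilon> (s i) \<omega> - 1) \<le> xs i})
    \<longlonglongrightarrow> H \<beta> q x powr (p * r)"
proof -
  define \<delta> where "\<delta> = reflected_innovation \<beta> \<epsilon>"
  define m where "m i = m_seq q (s i)" for i
  interpret ar1 M \<beta> q \<delta>
    unfolding \<delta>_def \<open>q = 1 - p\<close> by (rule ar1_reflected) fact+
  have m: "filterlim m at_top sequentially"
    unfolding m_def by (rule filterlim_compose[OF filterlim_m_seq[OF q] filterlim_subseq]) fact
  \<comment> \<open>Here \<open>s i\<close> is \<open>r_seq q (s i)\<close> times
    \<open>k_seq q (m i)\<close>, and the latter is asymptotic to
    \<open>(1 / q) ^ m i\<close>.\<close>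
  have n: "(\<lambda>i. real (s i) * q ^ m i) \<longlonglongrightarrow> r"
  proof -
    have "(\<lambda>i. r_seq q (s i) * (real (k_seq q (m i)) * q ^ m i)) \<longlonglongrightarrow> r * 1"
      by (intro tendsto_mult filterlim_compose[OF k_seq_asymp[OF q] m]) fact
    moreover have "r_seq q (s i) * (real (k_seq q (m i)) * q ^ m i) = real (s i) * q ^ m i" for i
      using k_seq_bounds(1)[OF q, of "m i"] by (simp add: r_seq_def m_def)
    ultimately show ?thesis by simp
  qed
  have "ar1_innovations M \<beta> p \<epsilon>" by fact
  then have [measurable]: "\<epsilon> j \<in> borel_measurable M" for j
    by (auto simp: ar1_innovations_def indep_vars_def)
  have [measurable]: "ar1_process \<beta> \<epsilon> k \<in> borel_measurable M" for k
    unfolding ar1_process_def[abs_def] by measurable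
  have max: "a_seq \<beta> q (s i) * (ar1_max \<beta> \<epsilon> (s i) \<omega> - 1) \<le> xs i
      \<longleftrightarrow> (\<forall>k<s i. ar1_process \<beta> \<epsilon> k \<omega> \<le> 1 - \<beta> ^ m i * (- xs i))" for i \<omega>
  proof -
    have "a_seq \<beta> q (s i) * (ar1_max \<beta> \<epsilon> (s i) \<omega> - 1) \<le> xs i
        \<longleftrightarrow> ar1_max \<beta> \<epsilon> (s i) \<omega> \<le> 1 - \<beta> ^ m i * (- xs i)"
      using \<beta> by (simp add: a_seq_def m_def field_simps)
    also have "\<dots> \<longleftrightarrow> (\<forall>k<s i. ar1_process \<beta> \<epsilon> k \<omega> \<le> 1 - \<beta> ^ m i * (- xs i))"
      unfolding ar1_max_def using \<open>1 \<le> s i\<close> by (subst Max_le_iff) auto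
    finally show ?thesis .
  qed
  have "prob {\<omega> \<in> space M. a_seq \<beta> q (s i) * (ar1_max \<beta> \<epsilon> (s i) \<omega> - 1) \<le> xs i}
      = prob {\<omega> \<in> space M. \<forall>k<s i. \<beta> ^ m i * (- xs i) \<le> Y k \<omega>}" for i
    unfolding max
  proof (rule finite_measure_eq_AE)
    have "AE \<omega> in M. \<forall>k. ar1_process \<beta> \<epsilon> k \<omega> = 1 - Y k \<omega>"
      unfolding \<delta>_def by (rule AE_reflected_process) fact+
    then show "AE \<omega> in M. \<omega> \<in> {\<omega> \<in> space M. \<forall>k<s i. ar1_process \<beta> \<epsilon> k \<omega> \<le> 1 - \<beta> ^ m i * (- xs i)}
        \<longleftrightarrow> \<omega> \<in> {\<omega> \<in> space M. \<forall>k<s i. \<beta> ^ m i * (- xs i) \<le> Y k \<omega>}"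
    proof eventually_elim
      case (elim \<omega>)
      have "ar1_process \<beta> \<epsilon> k \<omega> \<le> 1 - b \<longleftrightarrow> b \<le> Y k \<omega>" for k b
        using elim[rule_format, of k] by linarith
      then show ?case by (simp only: mem_Collect_eq)
    qed
  qed measurable
  moreover have "(\<lambda>i. prob {\<omega> \<in> space M. \<forall>k<s i. \<beta> ^ m i * (- xs i) \<le> Y k \<omega>})
      \<longlonglongrightarrow> exp (- ((1 - q) * (r * \<tau> (- x))))"
    by (rule tendsto_prob_min_ge[OF m _ _ n]) (use assms in \<open>auto intro: tendsto_minus\<close>)
  \<comment> \<open>The exit factor \<open>1 - q = p\<close> becomes part of the exponent, since
    \<open>H \<beta> q x = exp (- \<tau> (- x))\<close>.\<close>
  moreover have "exp (- ((1 - q) * (r * \<tau> (- x)))) = H \<beta> q x powr (p * r)"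
  proof -
    have "H \<beta> q x = exp (- \<tau> (- x))" using \<open>x < 0\<close> by (simp add: H_def \<tau>_def)
    moreover have "1 - q = p" using \<open>q = 1 - p\<close> by simp
    ultimately show ?thesis by (simp add: powr_def mult_ac)
  qed
  ultimately show ?thesis by simp
qed

end
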